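(* Let $\varphi$ be a $w^*$-continuous positive linear map on $B(\mathcal H)$. The following are equivalent: (i) $\varphi$ is similar to a $w^*$-continuous positive linear map $\psi$ on $B(\mathcal H)$ with $\|\psi\|<1$; (ii) for every invertible positive $R\in B(\mathcal H)$ the equation $X-\varphi(X)=R$ has an invertible positive solution in $B(\mathcal H)$; (iii) there is an invertible positive $Q\in B(\mathcal H)$ with $\varphi(Q)\le Q$ and $Q-\varphi(Q)$ invertible; (v) $\lim_{k\to\infty}\|\varphi^k(I)\|=0$; (vi) $r(\varphi)<1$. Moreover, in this case the positive solution of $X-\varphi(X)=R$ is unique and is given by $X=\sum_{k=0}^\infty\varphi^k(R)$, with convergence in the operator norm.
   Context: Two linear maps $\varphi,\lambda$ on $B(\mathcal H)$ are similar if there is an invertible $R\in B(\mathcal H)$ with $\varphi(RXR^* )=R\lambda(X)R^*$ for all $X$. The spectral radius is $r(\varphi):=\lim_{k\to\infty}\|\varphi^k\|^{1/k}$. (The paper's list of equivalent conditions has no item (iv).) *)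

theory Defs
  imports "HOL-Analysis.Analysis"
begin

class chilbert = real_normed_vector + complete_space +
  fixes scaleC :: "complex \<Rightarrow> 'a \<Rightarrow> 'a"
    and cinner :: "'a \<Rightarrow> 'a \<Rightarrow> complex"
  assumes scaleC_add_right: "scaleC a (x + y) = scaleC a x + scaleC a y"
    and scaleC_add_left: "scaleC (a + b) x = scaleC a x + scaleC b x"
    and scaleC_scaleC: "scaleC a (scaleC b x) = scaleC (a * b) x"
    and scaleC_one: "scaleC 1 x = x"
    and scaleR_scaleC: "scaleR r x = scaleC (complex_of_real r) x"
    and cinner_commute: "cinner x y = cnj (cinner y x)"
    and cinner_add_left: "cinner (x + y) z = cinner x z + cinner y z"
    and cinner_scaleC_left: "cinner (scaleC a x) y = a * cinner x y"
    and cinner_self: "cinner x x = complex_of_real ((norm x)\<^sup>2)"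

text \<open>Elements of B(H) are represented as functions H \<Rightarrow> H that are complex-linear
and bounded; their norm is the operator norm onorm.\<close>

definition bop :: "('a::chilbert \<Rightarrow> 'a) \<Rightarrow> bool" where
  "bop A \<longleftrightarrow> (\<forall>x y. A (x + y) = A x + A y) \<and> (\<forall>c x. A (scaleC c x) = scaleC c (A x))
     \<and> (\<exists>K. \<forall>x. norm (A x) \<le> norm x * K)"

definition BH :: "('a::chilbert \<Rightarrow> 'a) set" where
  "BH = {A. bop A}"

definition adj :: "('a::chilbert \<Rightarrow> 'a) \<Rightarrow> ('a \<Rightarrow> 'a)" where
  "adj A = (SOME B. bop B \<and> (\<forall>x y. cinner (A x) y = cinner x (B y)))"

definition invertible_op :: "('a::chilbert \<Rightarrow> 'a) \<Rightarrow> bool" where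
  "invertible_op A \<longleftrightarrow> bop A \<and> (\<exists>S. bop S \<and> (\<forall>x. S (A x) = x \<and> A (S x) = x))"

definition pos_op :: "('a::chilbert \<Rightarrow> 'a) \<Rightarrow> bool" where
  "pos_op A \<longleftrightarrow> bop A \<and> (\<forall>x. Im (cinner (A x) x) = 0 \<and> 0 \<le> Re (cinner (A x) x))"

definition op_le :: "('a::chilbert \<Rightarrow> 'a) \<Rightarrow> ('a \<Rightarrow> 'a) \<Rightarrow> bool" where
  "op_le A B \<longleftrightarrow> pos_op (\<lambda>x. B x - A x)"

definition linear_map_BH :: "(('a::chilbert \<Rightarrow> 'a) \<Rightarrow> ('a \<Rightarrow> 'a)) \<Rightarrow> bool" where
  "linear_map_BH \<phi> \<longleftrightarrow> (\<forall>X\<in>BH. \<phi> X \<in> BH) \<and>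
     (\<forall>X\<in>BH. \<forall>Y\<in>BH. \<forall>a b.
        \<phi> (\<lambda>x. scaleC a (X x) + scaleC b (Y x)) = (\<lambda>x. scaleC a (\<phi> X x) + scaleC b (\<phi> Y x)))"

definition positive_map :: "(('a::chilbert \<Rightarrow> 'a) \<Rightarrow> ('a \<Rightarrow> 'a)) \<Rightarrow> bool" where
  "positive_map \<phi> \<longleftrightarrow> linear_map_BH \<phi> \<and> (\<forall>X. pos_op X \<longrightarrow> pos_op (\<phi> X))"

definition map_norm :: "(('a::chilbert \<Rightarrow> 'a) \<Rightarrow> ('a \<Rightarrow> 'a)) \<Rightarrow> real" where
  "map_norm \<phi> = Sup {onorm (\<phi> X) | X. X \<in> BH \<and> onorm X \<le> 1}"

definition spectral_radius_map :: "(('a::chilbert \<Rightarrow> 'a) \<Rightarrow> ('a \<Rightarrow> 'a)) \<Rightarrow> real" where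
  "spectral_radius_map \<phi> = lim (\<lambda>k. map_norm (\<phi> ^^ k) powr (1 / real k))"

text \<open>The w*- (ultraweak) topology on B(H): the weak topology induced by the normal
functionals X |-> sum_n <X x_n, y_n> with sum_n |x_n|^2 < oo and sum_n |y_n|^2 < oo.\<close>
definition ultraweak_functional :: "(('a::chilbert \<Rightarrow> 'a) \<Rightarrow> complex) \<Rightarrow> bool" where
  "ultraweak_functional \<omega> \<longleftrightarrow> (\<exists>xs ys :: nat \<Rightarrow> 'a.
     summable (\<lambda>n. (norm (xs n))\<^sup>2) \<and> summable (\<lambda>n. (norm (ys n))\<^sup>2) \<and>
     (\<forall>X\<in>BH. \<omega> X = (\<Sum>n. cinner (X (xs n)) (ys n))))"

definition wstar_topology :: "('a::chilbert \<Rightarrow> 'a) topology" where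
  "wstar_topology = topology_generated_by
     (insert BH {{X\<in>BH. \<omega> X \<in> U} | \<omega> U. ultraweak_functional \<omega> \<and> open U})"

definition wstar_continuous :: "(('a::chilbert \<Rightarrow> 'a) \<Rightarrow> ('a \<Rightarrow> 'a)) \<Rightarrow> bool" where
  "wstar_continuous \<phi> \<longleftrightarrow> continuous_map wstar_topology wstar_topology \<phi>"

definition similar_maps :: "(('a::chilbert \<Rightarrow> 'a) \<Rightarrow> ('a \<Rightarrow> 'a)) \<Rightarrow> (('a \<Rightarrow> 'a) \<Rightarrow> ('a \<Rightarrow> 'a)) \<Rightarrow> bool" where
  "similar_maps \<phi> \<psi> \<longleftrightarrow> (\<exists>R. invertible_op R \<and>
     (\<forall>X\<in>BH. \<phi> (R \<circ> X \<circ> adj R) = R \<circ> \<psi> X \<circ> adj R))"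

end

theory Submission
  imports Defs
begin

text \<open>The implications run (ii) \<open>\<Rightarrow>\<close> (iii) \<open>\<Rightarrow>\<close> (i) \<open>\<Rightarrow>\<close> (v) \<open>\<Rightarrow>\<close> (vi) \<open>\<Rightarrow>\<close> (ii). If \<open>Q - \<phi>(Q)\<close> is positive and
  invertible then \<open>\<phi>(Q) \<le> c Q\<close> for some \<open>c < 1\<close>, so conjugating \<open>\<phi>\<close> by a self-adjoint square root
  of \<open>Q\<close> yields a positive map \<open>\<psi>\<close> with \<open>\<psi>(1) \<le> c\<close>; the Russo--Dye theorem \<open>\<parallel>\<psi>\<parallel> = \<parallel>\<psi>(1)\<parallel>\<close> makes it a
  strict contraction. The same theorem makes \<open>\<parallel>\<phi>\<^sup>k(1)\<parallel>\<close> submultiplicative, so Fekete's argument gives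
  the limit defining \<open>r(\<phi>)\<close>, and \<open>r(\<phi>) < 1\<close> gives norm convergence of \<open>\<Sum> \<phi>\<^sup>k(R)\<close>.

  Russo--Dye is proved without unitaries. For a strict contraction \<open>X\<close> and \<open>z\<^sup>N = 1\<close> the operators
  \<open>K\<^sub>z = S\<^sup>* (1 - X\<^sup>* X) S\<close> with \<open>S = \<Sum>n<N. (z X)\<^sup>n\<close> are positive, their average is at most \<open>1\<close>, and
  the average of \<open>z\<^sup>-\<^sup>1 K\<^sub>z\<close> tends to \<open>X\<close> as \<open>N\<close> grows.\<close>

section \<open>Operators on a complex Hilbert space\<close>

instance chilbert \<subseteq> banach ..

interpretation cvec: vector_space "scaleC :: complex \<Rightarrow> 'a \<Rightarrow> 'a::chilbert"
  by unfold_locales (simp_all add: scaleC_add_right scaleC_add_left scaleC_scaleC scaleC_one)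

lemma cinner_add_right: "cinner x (y + z) = cinner x y + cinner x z"
  by (metis cinner_commute cinner_add_left complex_cnj_add)

lemma cinner_scaleC_right: "cinner x (scaleC a y) = cnj a * cinner x y"
  by (metis cinner_commute cinner_scaleC_left complex_cnj_mult)

lemma cinner_minus_left: "cinner (- x) y = - cinner x y"
  using cinner_scaleC_left[of "-1" x y] by simp

lemma cinner_minus_right: "cinner x (- y) = - cinner x y"
  using cinner_scaleC_right[of x "-1" y] by simp

lemma cinner_diff_left: "cinner (x - y) z = cinner x z - cinner y z"
  using cinner_add_left[of x "- y" z] by (simp add: cinner_minus_left)

lemma cinner_diff_right: "cinner x (y - z) = cinner x y - cinner x z"
  using cinner_add_right[of x y "- z"] by (simp add: cinner_minus_right)

lemma cinner_scaleR_left: "cinner (r *\<^sub>R x) y = of_real r * cinner x y"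
  by (simp add: scaleR_scaleC cinner_scaleC_left)

lemma cinner_scaleR_right: "cinner x (r *\<^sub>R y) = of_real r * cinner x y"
  by (simp add: scaleR_scaleC cinner_scaleC_right)

lemma cinner_zero_left [simp]: "cinner 0 y = 0"
  using cinner_scaleC_left[of 0 0 y] by simp

lemma cinner_zero_right [simp]: "cinner x 0 = 0"
  using cinner_scaleC_right[of x 0 0] by simp

lemmas cinner_linear = cinner_add_left cinner_add_right cinner_diff_left cinner_diff_right
  cinner_minus_left cinner_minus_right cinner_scaleC_left cinner_scaleC_right
  cinner_scaleR_left cinner_scaleR_right

lemma cinner_sum_left: "cinner (\<Sum>i\<in>I. f i) y = (\<Sum>i\<in>I. cinner (f i) y)"
  by (induction I rule: infinite_finite_induct) (simp_all add: cinner_add_left)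

text \<open>The norm is by axiom homogeneous for real scalars only; the complex case is read off
  from \<open>cinner_self\<close>.\<close>

lemma norm_scaleC: "norm (scaleC c (x::'a::chilbert)) = cmod c * norm x"
proof -
  have "complex_of_real ((norm (scaleC c x))\<^sup>2) = (c * cnj c) * cinner x x"
    unfolding cinner_self[symmetric] by (simp add: cinner_linear)
  also have "\<dots> = complex_of_real ((cmod c * norm x)\<^sup>2)"
    by (simp add: complex_norm_square[symmetric] cinner_self power_mult_distrib)
  finally have "(norm (scaleC c x))\<^sup>2 = (cmod c * norm x)\<^sup>2"
    using of_real_eq_iff by blast
  then show ?thesis by (simp add: power2_eq_iff_nonneg)
qed

section \<open>Bounded complex-linear operators and their closure properties\<close>

lemma bop_iff:
  "bop A \<longleftrightarrow> bounded_linear A \<and> (\<forall>c x. A (scaleC c x) = scaleC c (A x))"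
proof
  assume A: "bop A"
  then obtain K where "\<And>x. norm (A x) \<le> norm x * K" unfolding bop_def by blast
  with A have "bounded_linear A"
    by (intro bounded_linear_intro[of A K]) (auto simp: bop_def scaleR_scaleC)
  with A show "bounded_linear A \<and> (\<forall>c x. A (scaleC c x) = scaleC c (A x))"
    by (auto simp: bop_def)
next
  assume A: "bounded_linear A \<and> (\<forall>c x. A (scaleC c x) = scaleC c (A x))"
  then obtain K where "\<And>x. norm (A x) \<le> norm x * K" using bounded_linear.bounded by blast
  with A show "bop A"
    by (auto simp: bop_def linear_simps)
qed

lemma bop_bounded_linear: "bop A \<Longrightarrow> bounded_linear A"
  and bop_scaleC: "bop A \<Longrightarrow> A (scaleC c x) = scaleC c (A x)"
  by (simp_all add: bop_iff)

lemma bop_add: "bop A \<Longrightarrow> A (x + y) = A x + A y"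
  and bop_diff: "bop A \<Longrightarrow> A (x - y) = A x - A y"
  and bop_minus: "bop A \<Longrightarrow> A (- x) = - A x"
  and bop_scaleR: "bop A \<Longrightarrow> A (r *\<^sub>R x) = r *\<^sub>R A x"
  and bop_zero: "bop A \<Longrightarrow> A 0 = 0"
  by (simp_all add: bop_iff linear_simps)

lemmas bop_linear = bop_add bop_diff bop_minus bop_scaleC bop_scaleR bop_zero

lemma bop_sum_arg: "bop A \<Longrightarrow> A (\<Sum>i\<in>I. f i) = (\<Sum>i\<in>I. A (f i))"
  by (induction I rule: infinite_finite_induct) (simp_all add: bop_linear)

lemma bop_norm: "bop A \<Longrightarrow> norm (A x) \<le> onorm A * norm x"
  by (simp add: bop_bounded_linear onorm)

lemma onorm_nonneg: "bop A \<Longrightarrow> 0 \<le> onorm A"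
  by (simp add: bop_bounded_linear onorm_pos_le)

lemma bop_id [simp]: "bop id" "bop (\<lambda>x. x)"
  by (simp_all add: bop_iff id_def bounded_linear_ident)

lemma bop_plus [simp, intro]: "bop A \<Longrightarrow> bop B \<Longrightarrow> bop (\<lambda>x. A x + B x)"
  by (simp add: bop_iff bounded_linear_add scaleC_add_right)

lemma bop_sub [simp, intro]: "bop A \<Longrightarrow> bop B \<Longrightarrow> bop (\<lambda>x. A x - B x)"
  by (simp add: bop_iff bounded_linear_sub cvec.scale_right_diff_distrib)

lemma bop_scale [simp, intro]:
  assumes "bop A" shows "bop (\<lambda>x. scaleC c (A x))"
proof -
  have "bounded_linear (\<lambda>x. scaleC c x :: 'a)"
    by (rule bounded_linear_intro[of _ "cmod c"])
      (simp_all add: scaleC_add_right scaleR_scaleC norm_scaleC mult.commute)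
  from bounded_linear_compose[OF this bop_bounded_linear[OF assms]] assms show ?thesis
    by (simp add: bop_iff mult.commute)
qed

lemma bop_scale_real [simp, intro]: "bop A \<Longrightarrow> bop (\<lambda>x. r *\<^sub>R A x)"
  by (simp add: scaleR_scaleC bop_scale)

lemma bop_comp: "bop A \<Longrightarrow> bop B \<Longrightarrow> bop (\<lambda>x. A (B x))"
  by (simp add: bop_iff bounded_linear_compose)

lemma bop_comp_fun [simp, intro]: "bop A \<Longrightarrow> bop B \<Longrightarrow> bop (A \<circ> B)"
  unfolding comp_def by (rule bop_comp)

lemma bop_sum [intro]: "(\<And>i. i \<in> I \<Longrightarrow> bop (f i)) \<Longrightarrow> bop (\<lambda>x. \<Sum>i\<in>I. f i x)"
  by (simp add: bop_iff bounded_linear_sum cvec.scale_sum_right)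

lemma bop_funpow [intro]: "bop A \<Longrightarrow> bop (A ^^ n)"
  by (induction n) (simp_all del: funpow.simps add: funpow.simps id_def bop_comp_fun)

section \<open>Positive operators and the Cauchy-Schwarz inequality\<close>

lemma pos_op_bop: "pos_op A \<Longrightarrow> bop A"
  by (simp add: pos_op_def)

lemma pos_op_nonneg: "pos_op A \<Longrightarrow> 0 \<le> Re (cinner (A x) x)"
  by (simp add: pos_op_def)

lemma pos_opI:
  assumes "bop A" "\<And>x y. cinner (A x) y = cinner x (A y)" "\<And>x. 0 \<le> Re (cinner (A x) x)"
  shows "pos_op A"
proof -
  have "Im (cinner (A x) x) = 0" for x
  proof -
    have "cinner (A x) x = cnj (cinner (A x) x)"
      using assms(2)[of x x] cinner_commute[of x "A x"] by simp
    then show ?thesis by (metis complex_cnj_cancel_iff Reals_cnj_iff complex_is_Real_iff)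
  qed
  with assms show ?thesis by (simp add: pos_op_def)
qed

text \<open>Polarization: reality of the quadratic form at \<open>x + y\<close> compares the
  imaginary parts of the two mixed terms, and at \<open>x + scaleC \<i> y\<close> their real
  parts.\<close>

lemma pos_op_symmetric:
  assumes "pos_op A" shows "cinner (A x) y = cinner x (A y)"
proof -
  have A: "bop A" and im: "\<And>v. Im (cinner (A v) v) = 0"
    using assms by (auto simp: pos_op_def)
  have "Im (cinner (A x) y) + Im (cinner (A y) x) = 0"
    using im[of "x + y"] im[of x] im[of y] by (simp add: bop_linear[OF A] cinner_linear)
  moreover have "Re (cinner (A y) x) = Re (cinner (A x) y)"
    using im[of "x + scaleC \<i> y"] im[of x] im[of y]
    by (simp add: bop_linear[OF A] cinner_linear)
  ultimately have "cinner (A x) y = cnj (cinner (A y) x)"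
    by (simp add: complex_eq_iff)
  then show ?thesis using cinner_commute by metis
qed

text \<open>Nonnegativity of the form at \<open>x - scaleC d y\<close> is expanded, where the
  unimodular \<open>d\<close> rotates the mixed term to minus its modulus. For \<open>A = id\<close>
  this is the source of Cauchy-Schwarz.\<close>

lemma pos_op_amgm:
  assumes "pos_op A"
  shows "2 * cmod (cinner (A x) y) \<le> Re (cinner (A x) x) + Re (cinner (A y) y)"
proof -
  have A: "bop A" using assms by (rule pos_op_bop)
  define h where "h = cinner (A x) y"
  obtain d where d: "cmod d = 1" "cnj d * h = of_real (cmod h)"
  proof (cases "h = 0")
    case True
    then show ?thesis using that[of 1] by simp
  next
    case False
    have "cnj (h / of_real (cmod h)) * h = of_real (cmod h)"
      using False complex_norm_square[of h]
      by (simp add: field_simps power2_eq_square)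
    with False show ?thesis using that[of "h / of_real (cmod h)"] by (simp add: norm_divide)
  qed
  have sym: "cinner (A y) x = cnj h"
    unfolding h_def using pos_op_symmetric[OF assms] cinner_commute by metis
  have "d * cnj h = of_real (cmod h)"
    using arg_cong[OF d(2), of cnj] by simp
  moreover have "d * cnj d = 1"
    using d(1) complex_norm_square[of d] by simp
  moreover have "cinner (A (x - scaleC d y)) (x - scaleC d y)
     = cinner (A x) x - cnj d * h - d * cnj h + (d * cnj d) * cinner (A y) y"
    by (simp add: bop_linear[OF A] cinner_linear sym algebra_simps flip: h_def)
  ultimately have "cinner (A (x - scaleC d y)) (x - scaleC d y)
     = cinner (A x) x - 2 * of_real (cmod h) + cinner (A y) y"
    using d(2) by simp
  then have "Re (cinner (A (x - scaleC d y)) (x - scaleC d y))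
     = Re (cinner (A x) x) - 2 * cmod h + Re (cinner (A y) y)"
    by simp
  then show ?thesis using pos_op_nonneg[OF assms, of "x - scaleC d y"] by (simp add: h_def)
qed

lemma pos_op_id: "pos_op id"
  by (simp add: pos_op_def cinner_self)

lemma cinner_bound: "cmod (cinner x y) \<le> norm x * norm y"
proof (cases "x = 0 \<or> y = 0")
  case False
  define u where "u = (1 / norm x) *\<^sub>R x"
  define v where "v = (1 / norm y) *\<^sub>R y"
  have "2 * cmod (cinner u v) \<le> (norm u)\<^sup>2 + (norm v)\<^sup>2"
    using pos_op_amgm[OF pos_op_id, of u v] by (simp add: cinner_self)
  also have "\<dots> = 2" using False by (simp add: u_def v_def)
  finally have "cmod (cinner u v) \<le> 1" by simp
  then show ?thesis using False
    by (simp add: u_def v_def cinner_linear norm_mult norm_divide field_simps)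
qed auto

lemma bounded_bilinear_cinner: "bounded_bilinear cinner"
  by (unfold_locales)
    (auto simp: cinner_linear scaleR_conv_of_real intro!: exI[of _ 1] cinner_bound)

section \<open>Riesz representation and adjoints\<close>

lemma quadratic_nonneg_imp_linear_coeff_eq_0:
  assumes "\<And>t::real. 0 \<le> 2 * t * a + t\<^sup>2 * b" "0 \<le> b"
  shows "a = (0::real)"
proof -
  \<comment> \<open>The minimiser would be \<open>- a / b\<close>; the added 1 also covers
    \<open>b = 0\<close>.\<close>
  define t where "t = - a / (b + 1)"
  have a: "a = - t * (b + 1)" using assms(2) by (simp add: t_def)
  have "0 \<le> - (t\<^sup>2 * (b + 2))"
    using assms(1)[of t] unfolding a by (simp add: algebra_simps power2_eq_square)
  then have "t = 0" using assms(2)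
    by (smt (verit) mult_pos_pos zero_less_power2)
  with a show ?thesis by simp
qed

text \<open>The representing vector is the minimiser of \<open>J\<close>. The parallelogram law
  makes a minimising sequence Cauchy, and vanishing of the first variation at the limit identifies
  the real part of \<open>f\<close>.\<close>

lemma riesz_representation:
  fixes f :: "'a::chilbert \<Rightarrow> complex"
  assumes f: "bounded_linear f" and fc: "\<And>c x. f (scaleC c x) = c * f x"
  shows "\<exists>y. \<forall>x. f x = cinner x y"
proof -
  define J where "J x = (norm x)\<^sup>2 - 2 * Re (f x)" for x
  obtain K where K: "\<And>x. norm (f x) \<le> norm x * K"
    using bounded_linear.bounded[OF f] by blast
  have J_below: "J x \<ge> - (K\<^sup>2)" for x
  proof -
    have "Re (f x) \<le> norm x * K" using K[of x] complex_Re_le_cmod[of "f x"] by linarith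
    then have "J x \<ge> (norm x - K)\<^sup>2 - K\<^sup>2"
      by (simp add: J_def power2_eq_square algebra_simps)
    then show ?thesis by (smt (verit) zero_le_power2)
  qed
  define m where "m = Inf (range J)"
  have bdd: "bdd_below (range J)" using J_below by (intro bdd_belowI[of _ "- (K\<^sup>2)"]) auto
  have m_le: "m \<le> J x" for x unfolding m_def by (intro cINF_lower bdd) simp
  have norm2: "(norm v)\<^sup>2 = Re (cinner v v)" for v :: 'a by (simp add: cinner_self)
  \<comment> \<open>The parallelogram law for \<open>J\<close>: its linear part takes the same value
    on both sides and cancels.\<close>
  have par: "J x + J y = 2 * J ((1/2) *\<^sub>R (x + y)) + (norm (x - y))\<^sup>2 / 2" for x y
    unfolding J_def norm2
    by (simp add: cinner_linear linear_simps[OF f] field_simps)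
  have "\<exists>x. J x < m + 1 / Suc n" for n
    using cINF_less_iff[of UNIV J "m + 1 / Suc n"] bdd unfolding m_def by auto
  then obtain x where x: "\<And>n. J (x n) < m + 1 / Suc n" by metis
  have dist: "(norm (x n - x p))\<^sup>2 \<le> 2 * (1 / Suc n + 1 / Suc p)" for n p
    using par[of "x n" "x p"] m_le[of "(1/2) *\<^sub>R (x n + x p)"] x[of n] x[of p] by simp
  have "Cauchy x"
  proof (rule CauchyI)
    fix e :: real assume e: "0 < e"
    obtain N :: nat where N: "4 / e\<^sup>2 < Suc N"
      using reals_Archimedean2[of "4 / e\<^sup>2"] by (metis less_trans lessI of_nat_less_iff)
    show "\<exists>M. \<forall>n\<ge>M. \<forall>p\<ge>M. norm (x n - x p) < e"
    proof (intro exI allI impI)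
      fix n p assume "N \<le> n" "N \<le> p"
      then have "1 / real (Suc n) + 1 / real (Suc p) \<le> 1 / Suc N + 1 / Suc N"
        by (intro add_mono divide_left_mono) auto
      with dist[of n p] have "(norm (x n - x p))\<^sup>2 \<le> 4 / Suc N" by simp
      also have "\<dots> < e\<^sup>2" using N e by (simp add: field_simps)
      finally show "norm (x n - x p) < e" using e by (simp add: power_less_imp_less_base)
    qed
  qed
  then obtain y where y: "x \<longlonglongrightarrow> y" using Cauchy_convergent convergent_def by blast
  have "(\<lambda>n. J (x n)) \<longlonglongrightarrow> J y"
    unfolding J_def by (intro tendsto_intros y bounded_linear.tendsto[OF f])
  moreover have "(\<lambda>n. m + 1 / Suc n) \<longlonglongrightarrow> m + 0"
    by (intro tendsto_intros LIMSEQ_Suc[OF lim_1_over_n])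
  ultimately have Jy: "J y \<le> m + 0"
    by (rule LIMSEQ_le) (use x less_imp_le in blast)
  have re: "Re (f v) = Re (cinner v y)" for v
  proof -
    have "0 \<le> 2 * t * (Re (cinner v y) - Re (f v)) + t\<^sup>2 * (norm v)\<^sup>2" for t
    proof -
      have "Re (cinner y v) = Re (cinner v y)" by (subst cinner_commute) simp
      then have "J (y + t *\<^sub>R v) = J y + 2 * t * (Re (cinner v y) - Re (f v)) + t\<^sup>2 * (norm v)\<^sup>2"
        unfolding J_def norm2
        by (simp add: cinner_linear linear_simps[OF f] algebra_simps power2_eq_square)
      then show ?thesis using m_le[of "y + t *\<^sub>R v"] Jy by linarith
    qed
    from quadratic_nonneg_imp_linear_coeff_eq_0[OF this] show ?thesis by simp
  qed
  \<comment> \<open>The imaginary part is the real part at \<open>scaleC \<i> v\<close>, up to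
    sign.\<close>
  have "f v = cinner v y" for v
    using re[of v] re[of "scaleC \<i> v"] by (simp add: fc cinner_linear complex_eq_iff)
  then show ?thesis by blast
qed

lemma cinner_ext:
  assumes "\<And>x. cinner x y = cinner x z" shows "y = z"
proof -
  have "cinner (y - z) (y - z) = 0" using assms by (simp add: cinner_linear)
  then show ?thesis by (simp add: cinner_self)
qed

lemma norm_le_if_cinner_le:
  assumes "cmod (cinner v v) \<le> c * norm v" "0 \<le> c"
  shows "norm v \<le> c"
  using assms by (cases "v = 0") (auto simp: cinner_self power2_eq_square norm_mult)

text \<open>Riesz is applied to \<open>x \<mapsto> cinner (A x) y\<close> for each \<open>y\<close>.
  Linearity of the resulting \<open>B\<close> follows from uniqueness of the representing vector,
  its bound from testing \<open>B y\<close> against itself.\<close>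

lemma adjoint_exists:
  assumes A: "bop A"
  shows "\<exists>B. bop B \<and> (\<forall>x y. cinner (A x) y = cinner x (B y))"
proof -
  have "\<exists>z. \<forall>x. cinner (A x) y = cinner x z" for y
  proof (rule riesz_representation)
    show "bounded_linear (\<lambda>x. cinner (A x) y)"
      using bounded_linear_compose[OF bounded_bilinear.bounded_linear_left[OF bounded_bilinear_cinner]
          bop_bounded_linear[OF A]] .
  qed (simp add: bop_linear[OF A] cinner_linear)
  then obtain B where B: "\<And>x y. cinner (A x) y = cinner x (B y)" by metis
  have "norm (B y) \<le> norm y * onorm A" for y
  proof -
    have "cmod (cinner (B y) (B y)) \<le> norm (A (B y)) * norm y"
      unfolding B[symmetric] by (rule cinner_bound)
    also have "\<dots> \<le> onorm A * norm (B y) * norm y"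
      by (intro mult_right_mono bop_norm A) simp
    finally show ?thesis
      using norm_le_if_cinner_le[of "B y" "norm y * onorm A"] onorm_nonneg[OF A]
      by (simp add: mult_ac)
  qed
  moreover have "B (x + y) = B x + B y" for x y
    by (rule cinner_ext) (simp add: cinner_linear B[symmetric])
  moreover have "B (scaleC c x) = scaleC c (B x)" for c x
    by (rule cinner_ext) (simp add: cinner_linear B[symmetric])
  ultimately have "bop B" unfolding bop_def by blast
  with B show ?thesis by blast
qed

lemma
  assumes "bop A"
  shows bop_adj [simp, intro]: "bop (adj A)"
    and cinner_adj: "cinner (A x) y = cinner x (adj A y)"
  using someI_ex[OF adjoint_exists[OF assms]] unfolding adj_def[symmetric] by auto

lemma cinner_adj': "bop A \<Longrightarrow> cinner (adj A x) y = cinner x (A y)"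
  by (metis cinner_adj cinner_commute)

lemma adj_unique:
  assumes "bop A" "\<And>x y. cinner (A x) y = cinner x (B y)"
  shows "adj A = B"
proof
  show "adj A y = B y" for y
    by (rule cinner_ext) (simp add: assms(2)[symmetric] cinner_adj[OF assms(1)])
qed

lemma onorm_adj_le:
  assumes A: "bop A" shows "onorm (adj A) \<le> onorm A"
proof (rule onorm_bound)
  show "norm (adj A y) \<le> onorm A * norm y" for y
  proof (rule norm_le_if_cinner_le)
    have "cmod (cinner (adj A y) (adj A y)) \<le> norm (A (adj A y)) * norm y"
      unfolding cinner_adj[OF A, symmetric] by (rule cinner_bound)
    also have "\<dots> \<le> onorm A * norm (adj A y) * norm y"
      by (intro mult_right_mono bop_norm A) simp
    finally show "cmod (cinner (adj A y) (adj A y)) \<le> onorm A * norm y * norm (adj A y)"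
      by (simp add: mult_ac)
  qed (simp add: onorm_nonneg[OF A])
qed (rule onorm_nonneg[OF A])

section \<open>Invertible positive operators\<close>

text \<open>In operator terms \<open>A^2 \<le> c A\<close>. It comes from the arithmetic-geometric
  inequality at \<open>y = (1 / c) *\<^sub>R A x\<close>, so no square root of \<open>A\<close> is
  involved.\<close>

lemma pos_op_norm_sq_le:
  assumes A: "pos_op A" and c: "0 < c" and le: "\<And>y. Re (cinner (A y) y) \<le> c * (norm y)\<^sup>2"
  shows "(norm (A x))\<^sup>2 \<le> c * Re (cinner (A x) x)"
proof -
  let ?y = "(1 / c) *\<^sub>R A x"
  have "2 * cmod (cinner (A x) ?y) \<le> Re (cinner (A x) x) + Re (cinner (A ?y) ?y)"
    by (rule pos_op_amgm[OF A])
  moreover have "cmod (cinner (A x) ?y) = (norm (A x))\<^sup>2 / c"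
    using c by (simp add: cinner_linear cinner_self norm_mult norm_divide norm_power)
  moreover have "Re (cinner (A ?y) ?y) \<le> (norm (A x))\<^sup>2 / c"
    using le[of ?y] c by (simp add: power_mult_distrib power_divide field_simps power2_eq_square)
  ultimately have "(norm (A x))\<^sup>2 / c \<le> Re (cinner (A x) x)" by simp
  then show ?thesis using c by (simp add: field_simps)
qed

lemma pos_op_norm_le:
  assumes A: "pos_op A" and c: "0 < c" and le: "\<And>y. Re (cinner (A y) y) \<le> c * (norm y)\<^sup>2"
  shows "norm (A x) \<le> c * norm x"
proof -
  have "(norm (A x))\<^sup>2 \<le> c * (c * (norm x)\<^sup>2)"
    using pos_op_norm_sq_le[OF assms, of x] mult_left_mono[OF le[of x], of c] c by linarith
  also have "\<dots> = (c * norm x)\<^sup>2" by (simp add: power2_eq_square)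
  finally show ?thesis by (rule power2_le_imp_le) (use c in simp)
qed

lemma Re_cinner_le_onorm: "bop A \<Longrightarrow> Re (cinner (A x) x) \<le> onorm A * (norm x)\<^sup>2"
  using cinner_bound[of "A x" x] complex_Re_le_cmod[of "cinner (A x) x"]
    mult_right_mono[OF bop_norm[of A x] norm_ge_zero[of x]]
  by (simp add: power2_eq_square mult_ac)

text \<open>Invertibility bounds \<open>norm x\<close> by \<open>L * norm (A x)\<close>, and
  positivity bounds the square of \<open>norm (A x)\<close> by \<open>M\<close> times the form;
  chaining gives the constant \<open>1 / (M * L\<^sup>2)\<close>. The added 1 in \<open>M\<close>
  and \<open>L\<close> keeps them positive on the zero space as well.\<close>

lemma pos_op_invertible_bounded_below:
  assumes A: "pos_op A" and inv: "invertible_op A"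
  obtains e where "0 < e" "\<And>x. e * (norm x)\<^sup>2 \<le> Re (cinner (A x) x)"
proof -
  from inv obtain S where S: "bop S" "\<And>x. S (A x) = x" unfolding invertible_op_def by blast
  define M where "M = onorm A + 1"
  define L where "L = onorm S + 1"
  have pos: "0 < M" "0 < L"
    using onorm_nonneg[OF pos_op_bop[OF A]] onorm_nonneg[OF S(1)] by (simp_all add: M_def L_def)
  have "1 / (M * L\<^sup>2) * (norm x)\<^sup>2 \<le> Re (cinner (A x) x)" for x
  proof -
    have "norm x \<le> L * norm (A x)"
      using add_increasing2[OF norm_ge_zero[of "A x"] bop_norm[OF S(1), of "A x"]] S(2)[of x]
      by (simp add: L_def distrib_right)
    then have "(norm x)\<^sup>2 \<le> L\<^sup>2 * (norm (A x))\<^sup>2"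
      by (metis norm_ge_zero power_mono power_mult_distrib)
    moreover have "(norm (A x))\<^sup>2 \<le> M * Re (cinner (A x) x)"
    proof (rule pos_op_norm_sq_le[OF A pos(1)])
      show "Re (cinner (A y) y) \<le> M * (norm y)\<^sup>2" for y
        using add_increasing2[OF zero_le_power2[of "norm y"] Re_cinner_le_onorm[OF pos_op_bop[OF A], of y]]
        by (simp add: M_def distrib_right)
    qed
    then have "L\<^sup>2 * (norm (A x))\<^sup>2 \<le> L\<^sup>2 * (M * Re (cinner (A x) x))"
      by (intro mult_left_mono) simp_all
    ultimately have "(norm x)\<^sup>2 \<le> L\<^sup>2 * (M * Re (cinner (A x) x))" by linarith
    then show ?thesis using pos by (simp add: field_simps)
  qed
  then show ?thesis using that[of "1 / (M * L\<^sup>2)"] pos by simp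
qed

lemma pos_op_contraction:
  assumes A: "pos_op A" and e: "0 < e" "\<And>x. e * (norm x)\<^sup>2 \<le> Re (cinner (A x) x)"
  obtains M q where "0 < M" "0 < q" "q < 1" "\<And>x. norm (x - (1 / M) *\<^sub>R A x) \<le> q * norm x"
proof -
  \<comment> \<open>Besides dominating the norm, \<open>M\<close> must exceed \<open>e\<close>, so
    that \<open>q = 1 - e / M\<close> is positive.\<close>
  define M where "M = onorm A + e + 1"
  define q where "q = 1 - e / M"
  have bA: "bop A" using A by (rule pos_op_bop)
  have M: "0 < M" "e < M" using onorm_nonneg[OF bA] e(1) by (simp_all add: M_def)
  have q: "0 < q" "q < 1" using M e(1) by (simp_all add: q_def)
  have Re: "Re (cinner (x - (1 / M) *\<^sub>R A x) x) = (norm x)\<^sup>2 - Re (cinner (A x) x) / M" for x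
    by (simp add: cinner_linear cinner_self)
  have "pos_op (\<lambda>x. x - (1 / M) *\<^sub>R A x)"
  proof (rule pos_opI)
    show "bop (\<lambda>x. x - (1 / M) *\<^sub>R A x)" using bA by auto
    show "cinner (x - (1 / M) *\<^sub>R A x) y = cinner x (y - (1 / M) *\<^sub>R A y)" for x y
      by (simp add: cinner_linear pos_op_symmetric[OF A])
    have "Re (cinner (A x) x) \<le> M * (norm x)\<^sup>2" for x
    proof -
      have "onorm A * (norm x)\<^sup>2 \<le> M * (norm x)\<^sup>2"
        using e(1) by (intro mult_right_mono) (simp_all add: M_def)
      then show ?thesis using Re_cinner_le_onorm[OF bA, of x] by linarith
    qed
    then show "0 \<le> Re (cinner (x - (1 / M) *\<^sub>R A x) x)" for x
      unfolding Re using M by (simp add: field_simps)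
  qed
  moreover have "Re (cinner (x - (1 / M) *\<^sub>R A x) x) \<le> q * (norm x)\<^sup>2" for x
    unfolding Re q_def using e(2)[of x] M by (simp add: field_simps)
  ultimately have "norm (x - (1 / M) *\<^sub>R A x) \<le> q * norm x" for x
    using q(1) by (intro pos_op_norm_le) auto
  with that M q show ?thesis by blast
qed

text \<open>Surjectivity is a fixed point problem for the contraction
  \<open>x \<mapsto> y / M + (x - A x / M)\<close>. Injectivity and boundedness of the inverse come
  from the lower bound.\<close>

lemma bounded_below_invertible:
  assumes A: "pos_op A" and e: "0 < e" "\<And>x. e * (norm x)\<^sup>2 \<le> Re (cinner (A x) x)"
  shows "invertible_op A"
proof -
  have bA: "bop A" using A by (rule pos_op_bop)
  obtain M q where M: "0 < M" "0 < q" "q < 1" and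
    contr: "\<And>x. norm (x - (1 / M) *\<^sub>R A x) \<le> q * norm x"
    using pos_op_contraction[OF assms] by blast
  have "\<exists>x. A x = y" for y
  proof -
    let ?f = "\<lambda>x. (1 / M) *\<^sub>R y + (x - (1 / M) *\<^sub>R A x)"
    have "\<exists>!x. ?f x = x"
    proof (rule banach_fix_type[of q])
      show "\<forall>u v. dist (?f u) (?f v) \<le> q * dist u v"
      proof (intro allI)
        fix u v
        have "?f u - ?f v = (u - v) - (1 / M) *\<^sub>R A (u - v)"
          by (simp add: bop_diff[OF bA] scaleR_diff_right)
        then show "dist (?f u) (?f v) \<le> q * dist u v"
          using contr[of "u - v"] unfolding dist_norm by metis
      qed
    qed (use M in auto)
    then obtain x where "?f x = x" by blast
    then have "(1 / M) *\<^sub>R (y - A x) = 0" by (simp add: algebra_simps)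
    then show ?thesis using M(1) by auto
  qed
  then obtain S where S: "\<And>y. A (S y) = y" by metis
  have lower: "e * norm x \<le> norm (A x)" for x
  proof (cases "x = 0")
    case False
    have "e * (norm x)\<^sup>2 \<le> norm (A x) * norm x"
      using e(2)[of x] complex_Re_le_cmod[of "cinner (A x) x"] cinner_bound[of "A x" x] by linarith
    with False show ?thesis by (simp add: power2_eq_square)
  qed (use bop_zero[OF bA] in simp)
  have inj: "x = y" if "A x = A y" for x y
    using lower[of "x - y"] that e(1) by (simp add: bop_linear[OF bA] mult_le_0_iff)
  have "bop S"
    unfolding bop_def
  proof (intro conjI allI exI)
    show "S (x + y) = S x + S y" for x y by (rule inj) (simp add: bop_linear[OF bA] S)
    show "S (scaleC c x) = scaleC c (S x)" for c x by (rule inj) (simp add: bop_linear[OF bA] S)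
    show "norm (S x) \<le> norm x * (1 / e)" for x using lower[of "S x"] e(1) by (simp add: S field_simps)
  qed
  moreover have "S (A x) = x" for x by (rule inj) (simp add: S)
  ultimately show ?thesis unfolding invertible_op_def using bA S by blast
qed

text \<open>Writing \<open>Q = M (1 - T)\<close> with \<open>\<parallel>T\<parallel> \<le> q < 1\<close>, a self-adjoint fixed point of
  \<open>Y \<mapsto> (T + Y\<^sup>2) / 2\<close> satisfies \<open>(1 - Y)\<^sup>2 = 1 - T\<close>.\<close>

lemma pos_op_square_root:
  assumes Q: "pos_op Q" and inv: "invertible_op Q"
  obtains R where "invertible_op R" "adj R = R" "\<And>x. R (R x) = Q x"
proof -
  have bQ: "bop Q" using Q by (rule pos_op_bop)
  obtain e where e: "0 < e" "\<And>x. e * (norm x)\<^sup>2 \<le> Re (cinner (Q x) x)"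
    using pos_op_invertible_bounded_below[OF assms] by blast
  obtain M q where M: "0 < M" "0 < q" "q < 1" and
    contr: "\<And>x. norm (x - (1 / M) *\<^sub>R Q x) \<le> q * norm x"
    using pos_op_contraction[OF Q e] by blast
  \<comment> \<open>The type of bounded linear functions supplies the complete metric space for
    Banach's theorem.\<close>
  define T where "T = Blinfun (\<lambda>x. x - (1 / M) *\<^sub>R Q x)"
  have T: "blinfun_apply T x = x - (1 / M) *\<^sub>R Q x" for x
    unfolding T_def using bQ by (subst bounded_linear_Blinfun_apply) (auto intro!: bop_bounded_linear)
  \<comment> \<open>Elements of this type are only real-linear. Keeping symmetry in \<open>S\<close>
    is what later makes \<open>R\<close> complex-linear and equal to its adjoint.\<close>
  define S where "S = {Y :: 'a \<Rightarrow>\<^sub>L 'a. norm Y \<le> q \<and> (\<forall>x y. cinner (blinfun_apply Y x) y = cinner x (blinfun_apply Y y))}"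
  define f where "f Y = (1/2) *\<^sub>R (T + (Y o\<^sub>L Y))" for Y
  have normT: "norm T \<le> q" using M by (intro norm_blinfun_bound) (simp_all add: T contr)
  have normYY: "norm (Y o\<^sub>L Z) \<le> q * norm Z" if "norm Y \<le> q" for Y Z :: "'a \<Rightarrow>\<^sub>L 'a"
    using norm_blinfun_compose[of Y Z] mult_right_mono[OF that norm_ge_zero[of Z]] by linarith
  have "closed {Y :: 'a \<Rightarrow>\<^sub>L 'a. cinner (blinfun_apply Y x) y = cinner x (blinfun_apply Y y)}" for x y
    by (intro closed_Collect_eq bounded_bilinear.continuous_on[OF bounded_bilinear_cinner] continuous_intros)
  moreover have "S = cball 0 q \<inter> (\<Inter>x. \<Inter>y. {Y. cinner (blinfun_apply Y x) y = cinner x (blinfun_apply Y y)})"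
    by (auto simp: S_def)
  ultimately have "closed S" by (simp only:) (intro closed_Int closed_INT ballI closed_cball)
  then have "complete S" by (simp add: complete_eq_closed)
  moreover have "S \<noteq> {}" using M by (auto simp: S_def intro!: exI[of _ 0])
  moreover have "f ` S \<subseteq> S"
  proof safe
    fix Y assume Y: "Y \<in> S"
    have "norm (Y o\<^sub>L Y) \<le> q * norm Y" using Y by (intro normYY) (simp add: S_def)
    also have "\<dots> \<le> 1 * q" using Y M by (intro mult_mono) (simp_all add: S_def)
    finally have "norm (f Y) \<le> q"
      using normT norm_triangle_ineq[of T "Y o\<^sub>L Y"] unfolding f_def norm_scaleR by linarith
    with Y show "f Y \<in> S"
      by (simp add: S_def f_def T blinfun.bilinear_simps cinner_linear pos_op_symmetric[OF Q])
  qed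
  moreover have "\<forall>Y\<in>S. \<forall>Z\<in>S. dist (f Y) (f Z) \<le> q * dist Y Z"
  proof safe
    fix Y Z assume Y: "Y \<in> S" and Z: "Z \<in> S"
    \<comment> \<open>This splitting of \<open>Y Y - Z Z\<close> requires no commutativity; each
      half contributes \<open>q\<close>, and the factor 1/2 leaves the Lipschitz constant
      \<open>q\<close>.\<close>
    have "f Y - f Z = (1/2) *\<^sub>R (((Y - Z) o\<^sub>L Y) + (Z o\<^sub>L (Y - Z)))"
      by (simp add: f_def bounded_bilinear.diff_left[OF bounded_bilinear_blinfun_compose]
          bounded_bilinear.diff_right[OF bounded_bilinear_blinfun_compose] flip: scaleR_diff_right)
    moreover have "norm ((Y - Z) o\<^sub>L Y) \<le> norm (Y - Z) * q"
      using norm_blinfun_compose[of "Y - Z" Y] mult_left_mono[of "norm Y" q "norm (Y - Z)"] Y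
      by (simp add: S_def)
    moreover have "norm (Z o\<^sub>L (Y - Z)) \<le> q * norm (Y - Z)" using Z by (intro normYY) (simp add: S_def)
    moreover have "norm (((Y - Z) o\<^sub>L Y) + (Z o\<^sub>L (Y - Z))) \<le> norm ((Y - Z) o\<^sub>L Y) + norm (Z o\<^sub>L (Y - Z))"
      by (rule norm_triangle_ineq)
    ultimately show "dist (f Y) (f Z) \<le> q * dist Y Z"
      by (simp add: dist_norm mult.commute)
  qed
  ultimately have "\<exists>!Y. Y \<in> S \<and> f Y = Y" using M by (intro Banach_fix[of S q]) auto
  then obtain Y where Y: "Y \<in> S" "f Y = Y" by blast
  define R where "R x = sqrt M *\<^sub>R (x - Y x)" for x
  have sym: "cinner (R x) y = cinner x (R y)" for x y
    using Y(1) by (simp add: R_def S_def cinner_linear)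
  have bR: "bop R"
    unfolding bop_iff
  proof (intro conjI allI)
    show "bounded_linear R" unfolding R_def by (intro bounded_linear_intros)
    show "R (scaleC c x) = scaleC c (R x)" for c x
      by (rule cinner_ext) (simp add: sym[symmetric] cinner_linear)
  qed
  have RR: "R (R x) = Q x" for x
  proof -
    have "2 *\<^sub>R Y x = T x + Y (Y x)"
      using arg_cong[OF Y(2), of "\<lambda>Z. 2 *\<^sub>R blinfun_apply Z x"]
      by (simp add: f_def blinfun.bilinear_simps)
    then have YY: "Y (Y x) = 2 *\<^sub>R Y x - x + (1 / M) *\<^sub>R Q x" by (simp add: T algebra_simps)
    have "R (R x) = (sqrt M * sqrt M) *\<^sub>R ((x - Y x) - (Y x - Y (Y x)))"
      by (simp add: R_def blinfun.bilinear_simps scaleR_diff_right)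
    also have "(x - Y x) - (Y x - Y (Y x)) = x - 2 *\<^sub>R Y x + Y (Y x)" by (simp add: scaleR_2)
    also have "sqrt M * sqrt M = M" using M(1) by simp
    also have "M *\<^sub>R (x - 2 *\<^sub>R Y x + Y (Y x)) = Q x" using M(1) by (simp add: YY)
    finally show ?thesis .
  qed
  from inv obtain P where P: "bop P" "\<And>x. P (Q x) = x" "\<And>x. Q (P x) = x"
    unfolding invertible_op_def by blast
  have "P (R (R x)) = x" "R (R (P x)) = x" for x by (simp_all add: RR P)
  \<comment> \<open>\<open>P R = P R (R R P) = (P R R) R P = R P\<close>; hence \<open>R P\<close>
    is a two-sided inverse of \<open>R\<close>.\<close>
  then have "P (R x) = R (P x)" for x by (metis (no_types))
  then have "R (R (P x)) = x \<and> R (P (R x)) = x" for x by (simp add: RR P)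
  then have "invertible_op R"
    unfolding invertible_op_def using bR bop_comp[OF bR P(1)] by blast
  then show ?thesis using that RR adj_unique[OF bR sym] by blast
qed

section \<open>Positive maps and the Russo--Dye theorem\<close>

lemma linear_map_bop: "linear_map_BH \<phi> \<Longrightarrow> bop X \<Longrightarrow> bop (\<phi> X)"
  by (simp add: linear_map_BH_def BH_def)

lemma linear_map_combination:
  assumes "linear_map_BH \<phi>" "bop X" "bop Y"
  shows "\<phi> (\<lambda>x. scaleC a (X x) + scaleC b (Y x)) = (\<lambda>x. scaleC a (\<phi> X x) + scaleC b (\<phi> Y x))"
proof -
  have mem: "X \<in> BH" "Y \<in> BH" using assms by (simp_all add: BH_def)
  have "\<forall>X\<in>BH. \<forall>Y\<in>BH. \<forall>a b. \<phi> (\<lambda>x. scaleC a (X x) + scaleC b (Y x))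
      = (\<lambda>x. scaleC a (\<phi> X x) + scaleC b (\<phi> Y x))"
    using assms(1) unfolding linear_map_BH_def by (rule conjunct2)
  from this[THEN bspec, OF mem(1), THEN bspec, OF mem(2), THEN spec, THEN spec] show ?thesis .
qed

lemma linear_map_add:
  assumes "linear_map_BH \<phi>" "bop X" "bop Y"
  shows "\<phi> (\<lambda>x. X x + Y x) = (\<lambda>x. \<phi> X x + \<phi> Y x)"
  using linear_map_combination[OF assms, of 1 1] by simp

lemma linear_map_diff:
  assumes "linear_map_BH \<phi>" "bop X" "bop Y"
  shows "\<phi> (\<lambda>x. X x - Y x) = (\<lambda>x. \<phi> X x - \<phi> Y x)"
  using linear_map_combination[OF assms, of 1 "-1"] by simp

lemma linear_map_scale:
  assumes "linear_map_BH \<phi>" "bop X"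
  shows "\<phi> (\<lambda>x. scaleC a (X x)) = (\<lambda>x. scaleC a (\<phi> X x))"
  using linear_map_combination[OF assms assms(2), of a 0] by simp

lemma linear_map_zero:
  assumes "linear_map_BH \<phi>" shows "\<phi> (\<lambda>x. 0) = (\<lambda>x. 0)"
  using linear_map_scale[OF assms bop_id(1), of 0] by simp

lemma linear_map_sum:
  assumes \<phi>: "linear_map_BH \<phi>" and "\<And>i. i \<in> I \<Longrightarrow> bop (F i)"
  shows "\<phi> (\<lambda>x. \<Sum>i\<in>I. scaleC (c i) (F i x)) = (\<lambda>x. \<Sum>i\<in>I. scaleC (c i) (\<phi> (F i) x))"
  using assms(2)
proof (induction I rule: infinite_finite_induct)
  case (insert i I)
  then have bop: "bop (F i)" "\<And>j. j \<in> I \<Longrightarrow> bop (F j)" by simp_all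
  have "\<phi> (\<lambda>x. \<Sum>j\<in>insert i I. scaleC (c j) (F j x))
     = \<phi> (\<lambda>x. scaleC (c i) (F i x) + (\<Sum>j\<in>I. scaleC (c j) (F j x)))"
    using insert.hyps by simp
  also have "\<dots> = (\<lambda>x. \<phi> (\<lambda>x. scaleC (c i) (F i x)) x + \<phi> (\<lambda>x. \<Sum>j\<in>I. scaleC (c j) (F j x)) x)"
    by (rule linear_map_add[OF \<phi> bop_scale[OF bop(1)] bop_sum[OF bop_scale[OF bop(2)]]])
  also have "\<dots> = (\<lambda>x. \<Sum>j\<in>insert i I. scaleC (c j) (\<phi> (F j) x))"
    using insert.hyps by (simp add: linear_map_scale[OF \<phi> bop(1)] insert.IH[OF bop(2)])
  finally show ?case .
next
  case (infinite I)
  then show ?case by (simp only: sum.infinite linear_map_zero[OF \<phi>] simp_thms)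
next
  case empty
  show ?case by (simp only: sum.empty linear_map_zero[OF \<phi>])
qed

section \<open>Norm bounds for positive maps, sharp on self-adjoint operators only\<close>

lemma positive_map_linear: "positive_map \<phi> \<Longrightarrow> linear_map_BH \<phi>"
  and positive_map_pos: "positive_map \<phi> \<Longrightarrow> pos_op X \<Longrightarrow> pos_op (\<phi> X)"
  by (simp_all add: positive_map_def)

lemma positive_map_bop: "positive_map \<phi> \<Longrightarrow> bop X \<Longrightarrow> bop (\<phi> X)"
  by (simp add: linear_map_bop[of \<phi>] positive_map_linear)

text \<open>Choosing \<open>y\<close> in the direction of \<open>T x\<close> with the length of
  \<open>x\<close> makes both squares equal and turns the form bound into a norm bound.\<close>

lemma onorm_le_form:
  assumes T: "bop T" and c: "0 \<le> c"
    and form: "\<And>x y. 2 * cmod (cinner (T x) y) \<le> c * ((norm x)\<^sup>2 + (norm y)\<^sup>2)"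
  shows "onorm T \<le> c"
proof (rule onorm_bound[OF c])
  fix x
  show "norm (T x) \<le> c * norm x"
  proof (cases "x = 0 \<or> T x = 0")
    case True
    then show ?thesis using c bop_zero[OF T] by auto
  next
    case False
    have "2 * (norm x * norm (T x)) \<le> c * ((norm x)\<^sup>2 + (norm x)\<^sup>2)"
      using form[of x "(norm x / norm (T x)) *\<^sub>R T x"] False
      by (simp add: cinner_linear cinner_self norm_mult norm_divide norm_power power2_eq_square)
    with False show ?thesis by (simp add: power2_eq_square)
  qed
qed

text \<open>With \<open>c = onorm A\<close> both \<open>c + A\<close> and \<open>c - A\<close> are
  positive, and \<phi> of their difference is \<open>2 * \<phi> A\<close>. Adding the two
  arithmetic-geometric inequalities for their images cancels the quadratic terms in
  \<open>\<phi> A\<close>, leaving only \<open>\<phi> id\<close>.\<close>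

lemma positive_map_bound_self_adjoint:
  assumes \<phi>: "positive_map \<phi>" and A: "bop A" and sym: "\<And>x y. cinner (A x) y = cinner x (A y)"
  shows "onorm (\<phi> A) \<le> onorm (\<phi> id) * onorm A"
proof -
  note L = positive_map_linear[OF \<phi>]
  define c where "c = onorm A"
  define P where "P s = (\<lambda>x. scaleC (of_real c) (id x) + scaleC (of_real s) (A x))" for s :: real
  have bid: "bop (\<phi> id)" by (rule positive_map_bop[OF \<phi> bop_id(1)])
  have P: "pos_op (P s)" if "\<bar>s\<bar> = 1" for s
  proof (rule pos_opI)
    show "bop (P s)" unfolding P_def using A by auto
    show "cinner (P s x) y = cinner x (P s y)" for x y by (simp add: P_def cinner_linear sym)
    have "\<bar>Re (cinner (A x) x)\<bar> \<le> c * (norm x)\<^sup>2" for x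
      using abs_Re_le_cmod[of "cinner (A x) x"] cinner_bound[of "A x" x]
        mult_right_mono[OF bop_norm[OF A, of x] norm_ge_zero[of x]]
      by (simp add: c_def power2_eq_square mult.assoc)
    then have "\<bar>s * Re (cinner (A x) x)\<bar> \<le> c * (norm x)\<^sup>2" for x
      using that by (simp add: abs_mult)
    then have "- (s * Re (cinner (A x) x)) \<le> c * (norm x)\<^sup>2" for x
      by (rule abs_le_D2)
    from add_right_mono[OF this] have "0 \<le> c * (norm x)\<^sup>2 + s * Re (cinner (A x) x)" for x
      by (metis add.left_inverse)
    then show "0 \<le> Re (cinner (P s x) x)" for x
      by (simp add: P_def cinner_linear cinner_self)
  qed
  have \<phi>P: "\<phi> (P s) = (\<lambda>x. scaleC (of_real c) (\<phi> id x) + scaleC (of_real s) (\<phi> A x))" for s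
    unfolding P_def by (rule linear_map_combination[OF L bop_id(1) A])
  have form: "cinner (\<phi> (P s) x) y = c * cinner (\<phi> id x) y + s * cinner (\<phi> A x) y" for s x y
    by (simp add: \<phi>P cinner_linear)
  show ?thesis
  proof (rule onorm_le_form)
    show "bop (\<phi> A)" by (rule positive_map_bop[OF \<phi> A])
    show "0 \<le> onorm (\<phi> id) * onorm A" by (simp add: onorm_nonneg bid A)
    fix x y
    have "2 * cmod (cinner (\<phi> (P 1) x) y) + 2 * cmod (cinner (\<phi> (P (-1)) x) y)
       \<le> 2 * (c * (Re (cinner (\<phi> id x) x) + Re (cinner (\<phi> id y) y)))"
      using pos_op_amgm[OF positive_map_pos[OF \<phi> P[of 1]], of x y]
        pos_op_amgm[OF positive_map_pos[OF \<phi> P[of "-1"]], of x y]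
      unfolding form by (simp add: algebra_simps)
    also have "\<dots> \<le> 2 * (c * (onorm (\<phi> id) * (norm x)\<^sup>2 + onorm (\<phi> id) * (norm y)\<^sup>2))"
      using onorm_nonneg[OF A] by (intro mult_left_mono add_mono Re_cinner_le_onorm bid) (simp_all add: c_def)
    finally have "cmod (cinner (\<phi> (P 1) x) y) + cmod (cinner (\<phi> (P (-1)) x) y)
      \<le> onorm (\<phi> id) * onorm A * ((norm x)\<^sup>2 + (norm y)\<^sup>2)"
      by (simp add: c_def algebra_simps)
    moreover have "2 * cinner (\<phi> A x) y = cinner (\<phi> (P 1) x) y - cinner (\<phi> (P (-1)) x) y"
      unfolding form by simp
    then have "cmod (2 * cinner (\<phi> A x) y) \<le> cmod (cinner (\<phi> (P 1) x) y) + cmod (cinner (\<phi> (P (-1)) x) y)"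
      by (simp only: norm_triangle_ineq4)
    then have "2 * cmod (cinner (\<phi> A x) y) \<le> cmod (cinner (\<phi> (P 1) x) y) + cmod (cinner (\<phi> (P (-1)) x) y)"
      by (simp only: norm_mult norm_numeral)
    ultimately show "2 * cmod (cinner (\<phi> A x) y) \<le> onorm (\<phi> id) * onorm A * ((norm x)\<^sup>2 + (norm y)\<^sup>2)"
      by linarith
  qed
qed

lemma onorm_le_sum:
  "bop A \<Longrightarrow> bop B \<Longrightarrow> onorm (\<lambda>x. A x + B x) \<le> onorm A + onorm B"
  by (simp add: onorm_triangle bop_bounded_linear)

lemma onorm_scaleC_le:
  assumes "bop A" shows "onorm (\<lambda>x. scaleC c (A x)) \<le> cmod c * onorm A"
  using mult_left_mono[OF bop_norm[OF assms] norm_ge_zero[of c]]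
  by (intro onorm_bound) (simp_all add: norm_scaleC onorm_nonneg assms mult.assoc)

text \<open>\<open>X = A / 2 - \<i> B / 2\<close> with self-adjoint \<open>A = X + adj X\<close> and
  \<open>B = \<i> (X - adj X)\<close>. The lost factor 2 is harmless for the error terms in
  \<open>russo_dye_strict\<close>.\<close>

lemma positive_map_bound_twice:
  assumes \<phi>: "positive_map \<phi>" and X: "bop X"
  shows "onorm (\<phi> X) \<le> 2 * onorm (\<phi> id) * onorm X"
proof -
  note L = positive_map_linear[OF \<phi>]
  define A where "A = (\<lambda>x. scaleC 1 (X x) + scaleC 1 (adj X x))"
  define B where "B = (\<lambda>x. scaleC \<i> (X x) + scaleC (-\<i>) (adj X x))"
  have bop: "bop A" "bop B" unfolding A_def B_def using X by auto
  have norm: "onorm (\<lambda>x. scaleC a (X x) + scaleC b (adj X x)) \<le> 2 * onorm X"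
    if "cmod a = 1" "cmod b = 1" for a b
  proof -
    have "onorm (\<lambda>x. scaleC a (X x) + scaleC b (adj X x))
      \<le> onorm (\<lambda>x. scaleC a (X x)) + onorm (\<lambda>x. scaleC b (adj X x))"
      by (intro onorm_le_sum bop_scale bop_adj X)
    also have "\<dots> \<le> 1 * onorm X + 1 * onorm (adj X)"
      using onorm_scaleC_le[OF X, of a] onorm_scaleC_le[OF bop_adj[OF X], of b] that
      by (intro add_mono) simp_all
    finally show ?thesis using onorm_adj_le[OF X] by simp
  qed
  have sym: "cinner (A x) y = cinner x (A y)" "cinner (B x) y = cinner x (B y)" for x y
    by (simp_all add: A_def B_def cinner_linear cinner_adj[OF X] cinner_adj'[OF X])
  have F: "0 \<le> onorm (\<phi> id)" by (rule onorm_nonneg[OF positive_map_bop[OF \<phi> bop_id(1)]])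
  have "onorm (\<phi> A) \<le> onorm (\<phi> id) * onorm A"
    by (rule positive_map_bound_self_adjoint[OF \<phi> bop(1) sym(1)])
  also have "\<dots> \<le> onorm (\<phi> id) * (2 * onorm X)"
    by (rule mult_left_mono[OF _ F]) (unfold A_def, rule norm, simp_all)
  finally have nA: "onorm (\<phi> A) \<le> 2 * onorm (\<phi> id) * onorm X" by simp
  have "onorm (\<phi> B) \<le> onorm (\<phi> id) * onorm B"
    by (rule positive_map_bound_self_adjoint[OF \<phi> bop(2) sym(2)])
  also have "\<dots> \<le> onorm (\<phi> id) * (2 * onorm X)"
    by (rule mult_left_mono[OF _ F]) (unfold B_def, rule norm, simp_all)
  finally have nB: "onorm (\<phi> B) \<le> 2 * onorm (\<phi> id) * onorm X" by simp
  have "X x = scaleC (1/2) (A x) + scaleC (-\<i>/2) (B x)" for x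
  proof -
    have "scaleC (1/2) (A x) + scaleC (-\<i>/2) (B x) = scaleC (1/2) (X x) + scaleC (1/2) (X x)"
      by (simp add: A_def B_def scaleC_add_right cvec.scale_right_diff_distrib)
    then show ?thesis unfolding scaleC_add_left[symmetric] by simp
  qed
  then have "X = (\<lambda>x. scaleC (1/2) (A x) + scaleC (-\<i>/2) (B x))" by (rule ext)
  then have "\<phi> X = \<phi> (\<lambda>x. scaleC (1/2) (A x) + scaleC (-\<i>/2) (B x))"
    by (rule arg_cong[of _ _ \<phi>])
  then have eq: "\<phi> X = (\<lambda>x. scaleC (1/2) (\<phi> A x) + scaleC (-\<i>/2) (\<phi> B x))"
    unfolding linear_map_combination[OF L bop] .
  have "onorm (\<phi> X) \<le> onorm (\<lambda>x. scaleC (1/2) (\<phi> A x)) + onorm (\<lambda>x. scaleC (-\<i>/2) (\<phi> B x))"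
    unfolding eq by (rule onorm_le_sum[OF bop_scale[OF positive_map_bop[OF \<phi> bop(1)]]
          bop_scale[OF positive_map_bop[OF \<phi> bop(2)]]])
  moreover note onorm_scaleC_le[OF positive_map_bop[OF \<phi> bop(1)], of "1/2"]
    onorm_scaleC_le[OF positive_map_bop[OF \<phi> bop(2)], of "-\<i>/2"]
  ultimately have "onorm (\<phi> X) \<le> cmod (1/2) * onorm (\<phi> A) + cmod (-\<i>/2) * onorm (\<phi> B)"
    by linarith
  with nA nB show ?thesis by (simp add: norm_divide)
qed

section \<open>Averaging over roots of unity and the sharp Russo-Dye bound\<close>

text \<open>The sum is geometric in \<open>w = cnj \<omega> ^ a * \<omega> ^ b\<close>, an
  \<open>N\<close>-th root of unity that is 1 exactly when \<open>a\<close> and \<open>b\<close>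
  agree modulo \<open>N\<close>.\<close>

lemma roots_of_unity_orthogonal:
  fixes N a b :: nat
  assumes N: "0 < N"
  defines "\<omega> \<equiv> exp (2 * of_real pi * \<i> / of_nat N) :: complex"
  shows "(\<Sum>j<N. cnj (\<omega> ^ j) ^ a * (\<omega> ^ j) ^ b) = (if a mod N = b mod N then of_nat N else 0)"
proof -
  define w where "w = cnj \<omega> ^ a * \<omega> ^ b"
  have pow: "\<omega> ^ k = exp (2 * of_real pi * \<i> * of_nat k / of_nat N)" for k
    by (simp add: \<omega>_def flip: exp_of_nat_mult) (simp add: mult_ac)
  have unit: "cnj \<omega> * \<omega> = 1"
    unfolding \<omega>_def exp_cnj by (simp flip: exp_add)
  have "\<omega> ^ N = 1" unfolding pow using N by (simp add: exp_eq_1 mult.commute)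
  then have wN: "w ^ N = 1"
    unfolding w_def power_mult_distrib
    by (metis complex_cnj_one complex_cnj_power power_commutes power_mult power_one mult.commute mult_1)
  have "w = 1 \<longleftrightarrow> \<omega> ^ a = \<omega> ^ b"
  proof
    have u: "cnj \<omega> ^ a * \<omega> ^ a = 1" using unit by (simp flip: power_mult_distrib)
    {
      assume "w = 1"
      then have "\<omega> ^ a * (cnj \<omega> ^ a * \<omega> ^ b) = \<omega> ^ a" by (simp add: w_def)
      with u show "\<omega> ^ a = \<omega> ^ b" by (metis mult.commute mult.left_commute mult_1_right)
    }
    show "\<omega> ^ a = \<omega> ^ b \<Longrightarrow> w = 1" using u by (simp add: w_def)
  qed
  also have "\<dots> \<longleftrightarrow> a mod N = b mod N"
    unfolding pow using N by (intro complex_root_unity_eq) simp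
  finally have w1: "w = 1 \<longleftrightarrow> a mod N = b mod N" .
  have "(\<Sum>j<N. cnj (\<omega> ^ j) ^ a * (\<omega> ^ j) ^ b) = (\<Sum>j<N. w ^ j)"
    by (intro sum.cong refl) (simp add: w_def power_mult_distrib flip: power_mult complex_cnj_power, simp add: mult.commute)
  also have "\<dots> = (if w = 1 then of_nat N else 0)"
    using wN by (simp add: sum_gp_strict)
  finally show ?thesis by (simp add: w1)
qed

text \<open>The identity \<open>(1/N) \<Sum> z\<^sup>-\<^sup>1 K\<^sub>z = X - X\<^sup>*\<^sup>p X\<^sup>N + X\<^sup>*\<^sup>p - X\<^sup>*\<^sup>N X\<close> behind the Russo--Dye
  estimate, with \<open>N = p + 1\<close>, read off for a scalar functional whose value at \<open>X\<^sup>*\<^sup>m X\<^sup>n\<close> is \<open>g m n\<close>.\<close>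

lemma kernel_average:
  fixes g :: "nat \<Rightarrow> nat \<Rightarrow> complex" and p :: nat
  defines "\<omega> \<equiv> exp (2 * of_real pi * \<i> / of_nat (Suc p)) :: complex"
  defines "k z \<equiv> \<Sum>m<Suc p. \<Sum>n<Suc p. (cnj z ^ m * z ^ n) * (g m n - g (Suc m) (Suc n))"
  shows "(\<Sum>j<Suc p. k (\<omega> ^ j)) = of_nat (Suc p) * (g 0 0 - g (Suc p) (Suc p))"
    and "1 \<le> p \<Longrightarrow> (\<Sum>j<Suc p. cnj (\<omega> ^ j) * k (\<omega> ^ j))
      = of_nat (Suc p) * (g 0 1 - g p (Suc p) + g p 0 - g (Suc p) 1)"
proof -
  let ?N = "Suc p"
  define h where "h m n = g m n - g (Suc m) (Suc n)" for m n
  \<comment> \<open>The exponents \<open>a = 0\<close> and \<open>a = 1\<close> yield the two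
    claims; orthogonality keeps only the pairs with \<open>n\<close> congruent to
    \<open>m + a\<close> modulo \<open>?N\<close>.\<close>
  have swap: "(\<Sum>j<?N. cnj (\<omega> ^ j) ^ a * k (\<omega> ^ j))
     = (\<Sum>m<?N. \<Sum>n<?N. (if (m + a) mod ?N = n mod ?N then of_nat ?N else 0) * h m n)" for a
  proof -
    have "(\<Sum>j<?N. cnj (\<omega> ^ j) ^ a * k (\<omega> ^ j))
      = (\<Sum>j<?N. \<Sum>m<?N. \<Sum>n<?N. (cnj (\<omega> ^ j) ^ (m + a) * (\<omega> ^ j) ^ n) * h m n)"
      unfolding k_def h_def by (simp only: sum_distrib_left power_add mult_ac)
    also have "\<dots> = (\<Sum>m<?N. \<Sum>n<?N. \<Sum>j<?N. (cnj (\<omega> ^ j) ^ (m + a) * (\<omega> ^ j) ^ n) * h m n)"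
      by (subst sum.swap) (intro sum.cong refl sum.swap)
    also have "\<dots> = (\<Sum>m<?N. \<Sum>n<?N. (if (m + a) mod ?N = n mod ?N then of_nat ?N else 0) * h m n)"
      by (intro sum.cong refl) (simp only: sum_distrib_right[symmetric] roots_of_unity_orthogonal[of ?N, folded \<omega>_def] zero_less_Suc)
    finally show ?thesis .
  qed
  have pick: "(\<Sum>m<?N. \<Sum>n<?N. (if (m + a) mod ?N = n mod ?N then of_nat ?N else 0) * h m n)
     = of_nat ?N * (\<Sum>m<?N. h m ((m + a) mod ?N))" for a
  proof -
    have "(\<Sum>n<?N. (if (m + a) mod ?N = n mod ?N then of_nat ?N else 0) * h m n)
       = (\<Sum>n<?N. if n = (m + a) mod ?N then of_nat ?N * h m n else 0)" for m
      by (intro sum.cong refl) auto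
    also have "\<dots> m = of_nat ?N * h m ((m + a) mod ?N)" for m
      by (subst sum.delta) (simp_all del: of_nat_Suc)
    finally show ?thesis by (simp only: sum_distrib_left)
  qed
  have "(\<Sum>m<?N. h m ((m + 0) mod ?N)) = (\<Sum>m<?N. g m m - g (Suc m) (Suc m))"
    by (intro sum.cong refl) (simp add: h_def)
  also have "\<dots> = g 0 0 - g ?N ?N" by (rule sum_lessThan_telescope')
  finally show "(\<Sum>j<?N. k (\<omega> ^ j)) = of_nat ?N * (g 0 0 - g ?N ?N)"
    using swap[of 0] unfolding pick by simp
  assume p: "1 \<le> p"
  \<comment> \<open>The shifted index wraps around once, at \<open>m = p\<close>. The other terms
    telescope, and \<open>h p 0\<close> is the source of the two terms \<open>g p 0\<close> and
    \<open>g ?N 1\<close>.\<close>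
  have "(\<Sum>m<?N. h m ((m + 1) mod ?N)) = (\<Sum>m<p. h m (Suc m)) + h p 0"
    by simp
  also have "(\<Sum>m<p. h m (Suc m)) = g 0 (Suc 0) - g p (Suc p)"
    unfolding h_def by (rule sum_lessThan_telescope')
  finally show "(\<Sum>j<?N. cnj (\<omega> ^ j) * k (\<omega> ^ j)) = of_nat ?N * (g 0 1 - g p ?N + g p 0 - g ?N 1)"
    using swap[of 1] unfolding pick by (simp add: h_def del: of_nat_Suc)
qed

lemma cinner_sum_right: "cinner y (\<Sum>i\<in>I. f i) = (\<Sum>i\<in>I. cinner y (f i))"
  by (induction I rule: infinite_finite_induct) (simp_all add: cinner_add_right)

lemma cinner_funpow:
  fixes A B :: "'a::chilbert \<Rightarrow> 'a"
  assumes "\<And>x y. cinner (A x) y = cinner x (B y)"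
  shows "cinner ((A ^^ m) x) y = cinner x ((B ^^ m) y)"
  by (induction m arbitrary: x y) (simp_all add: assms funpow_swap1)

lemma norm_funpow_le:
  fixes A :: "'a::real_normed_vector \<Rightarrow> 'a"
  assumes "\<And>x. norm (A x) \<le> r * norm x" "0 \<le> r"
  shows "norm ((A ^^ n) x) \<le> r ^ n * norm x"
proof (induction n)
  case (Suc n)
  have "norm ((A ^^ Suc n) x) \<le> r * norm ((A ^^ n) x)" using assms(1) by simp
  also have "\<dots> \<le> r * (r ^ n * norm x)" using Suc assms(2) by (intro mult_left_mono)
  finally show ?case by simp
qed simp

text \<open>The bound survives averaging over the roots of unity because it comes from
  \<open>2 \<bar>\<langle>A x, y\<rangle>\<bar> \<le> \<langle>A x, x\<rangle> + \<langle>A y, y\<rangle>\<close>, whose right-hand side is linear in the positive operator \<open>A\<close>.\<close>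

lemma positive_map_kernel_estimate:
  fixes p :: nat
  assumes \<phi>: "positive_map \<phi>" and X: "bop X" and le1: "onorm X \<le> 1" and p: "1 \<le> p"
  defines "g u v m n \<equiv> cinner (\<phi> ((adj X ^^ m) \<circ> (X ^^ n)) u) v"
  shows "2 * cmod (g x y 0 1 - g x y p (Suc p) + g x y p 0 - g x y (Suc p) 1)
    \<le> onorm (\<phi> id) * ((norm x)\<^sup>2 + (norm y)\<^sup>2)"
proof -
  let ?N = "Suc p"
  note L = positive_map_linear[OF \<phi>]
  define \<omega> where "\<omega> = exp (2 * of_real pi * \<i> / of_nat ?N :: complex)"
  \<comment> \<open>\<open>H m n\<close> is \<open>(adj X)^m (1 - (adj X) X) X^n\<close>, so the
    \<open>K z\<close> below is the operator \<open>K\<^sub>z\<close> of the outline multiplied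
    out.\<close>
  define H where "H m n = (\<lambda>v. ((adj X ^^ m) \<circ> (X ^^ n)) v - ((adj X ^^ Suc m) \<circ> (X ^^ Suc n)) v)" for m n
  define I where "I = {..<?N} \<times> {..<?N}"
  define c where "c z = (\<lambda>(m, n). cnj z ^ m * z ^ n)" for z :: complex
  define K where "K z = (\<lambda>v. \<Sum>i\<in>I. scaleC (c z i) (case i of (m, n) \<Rightarrow> H m n v))" for z
  define k where "k u v z = (\<Sum>m<?N. \<Sum>n<?N. (cnj z ^ m * z ^ n) * (g u v m n - g u v (Suc m) (Suc n)))" for u v z
  have bG: "bop ((adj X ^^ m) \<circ> (X ^^ n))" for m n
    using X by (intro bop_comp_fun bop_funpow bop_adj)
  have bH: "bop (case i of (m, n) \<Rightarrow> H m n)" for i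
    unfolding H_def by (cases i) (simp only: prod.case, intro bop_sub bG)
  have K_eq: "K z = (\<lambda>v. \<Sum>i\<in>I. scaleC (c z i) ((case i of (m, n) \<Rightarrow> H m n) v))" for z
    unfolding K_def by (intro ext sum.cong refl) (simp split: prod.split)
  have bK: "bop (K z)" for z
    unfolding K_eq by (intro bop_sum bop_scale bH)
  \<comment> \<open>With \<open>s u\<close> denoting the sum of
    \<open>scaleC (z ^ n) ((X ^^ n) u)\<close>, the form is that of \<open>s u\<close> and
    \<open>s v\<close> minus that of their images under \<open>X\<close>. On the diagonal it is
    nonnegative since \<open>X\<close> is a contraction.\<close>
  have formK: "cinner (K z u) v
    = cinner ((\<Sum>n<?N. scaleC (z ^ n) ((X ^^ n) u))) (\<Sum>m<?N. scaleC (z ^ m) ((X ^^ m) v))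
      - cinner (X (\<Sum>n<?N. scaleC (z ^ n) ((X ^^ n) u))) (X (\<Sum>m<?N. scaleC (z ^ m) ((X ^^ m) v)))" for z u v
  proof -
    have H: "cinner (H m n u) v = cinner ((X ^^ n) u) ((X ^^ m) v) - cinner (X ((X ^^ n) u)) (X ((X ^^ m) v))" for m n
      unfolding H_def
      by (simp add: cinner_linear cinner_funpow[OF cinner_adj'[OF X]] cinner_adj'[OF X] del: funpow.simps)
        (simp add: cinner_linear cinner_funpow[OF cinner_adj'[OF X]] cinner_adj'[OF X])
    have "cinner (K z u) v = (\<Sum>m<?N. \<Sum>n<?N. cnj (z ^ m) * (z ^ n) * cinner (H m n u) v)"
      unfolding K_def I_def c_def
      by (simp only: cinner_sum_left cinner_linear sum.cartesian_product case_prod_unfold complex_cnj_power)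
    also have "\<dots> = (\<Sum>m<?N. \<Sum>n<?N. cnj (z ^ m) * (z ^ n * cinner ((X ^^ n) u) ((X ^^ m) v)))
       - (\<Sum>m<?N. \<Sum>n<?N. cnj (z ^ m) * (z ^ n * cinner (X ((X ^^ n) u)) (X ((X ^^ m) v))))"
      unfolding H sum_subtractf[symmetric] by (intro sum.cong refl) (simp only: algebra_simps)
    finally show ?thesis
      by (simp only: cinner_sum_left cinner_sum_right bop_sum_arg[OF X] bop_scaleC[OF X] cinner_linear
          sum_distrib_left)
  qed
  have posK: "pos_op (K z)" for z
  proof (rule pos_opI[OF bK])
    show "cinner (K z u) v = cinner u (K z v)" for u v
      by (subst (2) cinner_commute, unfold formK complex_cnj_diff) (simp only: cinner_commute[symmetric])
    let ?s = "\<lambda>u. \<Sum>n<?N. scaleC (z ^ n) ((X ^^ n) u)"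
    have "norm (X (?s u)) \<le> norm (?s u)" for u
      using bop_norm[OF X, of "?s u"] mult_right_mono[OF le1 norm_ge_zero[of "?s u"]] by linarith
    then have "(norm (X (?s u)))\<^sup>2 \<le> (norm (?s u))\<^sup>2" for u by (intro power_mono) auto
    then show "0 \<le> Re (cinner (K z u) u)" for u
      unfolding formK cinner_self by simp
  qed
  have form\<phi>K: "cinner (\<phi> (K z) u) v = k u v z" for z u v
  proof -
    have "cinner (\<phi> (H m n) u) v = g u v m n - g u v (Suc m) (Suc n)" for m n
      unfolding H_def linear_map_diff[OF L bG bG] g_def by (simp only: cinner_linear)
    then show ?thesis
      unfolding K_eq linear_map_sum[OF L bH] k_def I_def c_def
      by (simp add: cinner_sum_left cinner_linear sum.cartesian_product case_prod_unfold del: funpow.simps sum.lessThan_Suc)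
  qed
  have diag: "(\<Sum>j<?N. Re (k u u (\<omega> ^ j))) \<le> real ?N * (onorm (\<phi> id) * (norm u)\<^sup>2)" for u
  proof -
    have "pos_op ((adj X ^^ ?N) \<circ> (X ^^ ?N))"
    proof (rule pos_opI[OF bG])
      show "cinner (((adj X ^^ ?N) \<circ> (X ^^ ?N)) a) b = cinner a (((adj X ^^ ?N) \<circ> (X ^^ ?N)) b)" for a b
        by (simp only: comp_apply cinner_funpow[OF cinner_adj'[OF X]] cinner_funpow[OF cinner_adj[OF X]])
      show "0 \<le> Re (cinner (((adj X ^^ ?N) \<circ> (X ^^ ?N)) a) a)" for a
        by (simp only: comp_apply cinner_funpow[OF cinner_adj'[OF X]]) (simp add: cinner_self)
    qed
    then have nn: "0 \<le> Re (g u u ?N ?N)"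
      unfolding g_def by (intro pos_op_nonneg positive_map_pos[OF \<phi>])
    have "g u u 0 0 = cinner (\<phi> id u) u" by (simp add: g_def)
    then have g00: "Re (g u u 0 0) \<le> onorm (\<phi> id) * (norm u)\<^sup>2"
      using Re_cinner_le_onorm[OF positive_map_bop[OF \<phi> bop_id(1)], of u] by simp
    have "(\<Sum>j<?N. Re (k u u (\<omega> ^ j))) = Re (of_nat ?N * (g u u 0 0 - g u u ?N ?N))"
      unfolding Re_sum[symmetric] k_def \<omega>_def kernel_average(1) ..
    also have "\<dots> = real ?N * (Re (g u u 0 0) - Re (g u u ?N ?N))" by (simp del: of_nat_Suc)
    also have "\<dots> \<le> real ?N * (onorm (\<phi> id) * (norm u)\<^sup>2)"
      using nn g00 by (intro mult_left_mono) auto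
    finally show ?thesis .
  qed
  have unit: "cmod (cnj (\<omega> ^ j)) = 1" for j
    by (simp add: \<omega>_def norm_power)
  have "real ?N * (2 * cmod (g x y 0 1 - g x y p ?N + g x y p 0 - g x y ?N 1))
     = 2 * cmod (of_nat ?N * (g x y 0 1 - g x y p ?N + g x y p 0 - g x y ?N 1))"
    by (simp only: norm_mult norm_of_nat)
  also have "\<dots> = 2 * cmod (\<Sum>j<?N. cnj (\<omega> ^ j) * k x y (\<omega> ^ j))"
    unfolding k_def \<omega>_def kernel_average(2)[OF p] ..
  also have "\<dots> \<le> 2 * (\<Sum>j<?N. cmod (k x y (\<omega> ^ j)))"
    using norm_sum[of "\<lambda>j. cnj (\<omega> ^ j) * k x y (\<omega> ^ j)" "{..<?N}"]
    by (simp only: norm_mult unit mult_1)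
  also have "\<dots> \<le> (\<Sum>j<?N. Re (k x x (\<omega> ^ j)) + Re (k y y (\<omega> ^ j)))"
    unfolding sum_distrib_left form\<phi>K[symmetric]
    by (intro sum_mono pos_op_amgm positive_map_pos[OF \<phi>] posK)
  also have "\<dots> \<le> real ?N * (onorm (\<phi> id) * ((norm x)\<^sup>2 + (norm y)\<^sup>2))"
    unfolding sum.distrib using diag[of x] diag[of y] by (simp add: distrib_left)
  finally show ?thesis by (simp del: of_nat_Suc)
qed

lemma onorm_adj_funpow_comp_funpow_le:
  assumes X: "bop X" and le1: "onorm X \<le> 1"
  shows "onorm ((adj X ^^ m) \<circ> (X ^^ n)) \<le> onorm X ^ (m + n)"
proof (rule onorm_bound)
  let ?r = "onorm X"
  have r: "0 \<le> ?r" by (rule onorm_nonneg[OF X])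
  have adj: "norm (adj X x) \<le> ?r * norm x" for x
    using bop_norm[OF bop_adj[OF X], of x] mult_right_mono[OF onorm_adj_le[OF X] norm_ge_zero[of x]]
    by linarith
  fix x
  have "norm ((adj X ^^ m) ((X ^^ n) x)) \<le> ?r ^ m * norm ((X ^^ n) x)"
    by (rule norm_funpow_le[OF adj r])
  also have "\<dots> \<le> ?r ^ m * (?r ^ n * norm x)"
    using r by (intro mult_left_mono norm_funpow_le bop_norm X) simp_all
  finally show "norm (((adj X ^^ m) \<circ> (X ^^ n)) x) \<le> ?r ^ (m + n) * norm x"
    by (simp add: power_add mult.assoc)
qed (simp add: onorm_nonneg X)

text \<open>In the kernel estimate the three terms other than \<open>g 0 1\<close> involve at least
  \<open>p\<close> factors of \<open>X\<close> or \<open>adj X\<close>. The crude bound makes each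
  at most \<open>C * ?r ^ p\<close>, which vanishes as \<open>p\<close> grows.\<close>

lemma russo_dye_strict:
  assumes \<phi>: "positive_map \<phi>" and X: "bop X" and less1: "onorm X < 1"
  shows "onorm (\<phi> X) \<le> onorm (\<phi> id)"
proof (rule onorm_le_form[OF positive_map_bop[OF \<phi> X]])
  let ?F = "onorm (\<phi> id)" and ?r = "onorm X"
  show F: "0 \<le> ?F" by (rule onorm_nonneg[OF positive_map_bop[OF \<phi> bop_id(1)]])
  have r: "0 \<le> ?r" by (rule onorm_nonneg[OF X])
  fix x y
  define g where "g m n = cinner (\<phi> ((adj X ^^ m) \<circ> (X ^^ n)) x) y" for m n
  define C where "C = 2 * ?F * (norm x * norm y)"
  define B where "B = ?F * ((norm x)\<^sup>2 + (norm y)\<^sup>2)"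
  have C: "0 \<le> C" using F by (simp add: C_def)
  have g: "cmod (g m n) \<le> C * ?r ^ p" if "p \<le> m + n" for m n p
  proof -
    let ?T = "(adj X ^^ m) \<circ> (X ^^ n)"
    have T: "bop ?T" using X by (intro bop_comp_fun bop_funpow bop_adj)
    have "onorm ?T \<le> ?r ^ (m + n)"
      by (rule onorm_adj_funpow_comp_funpow_le[OF X less_imp_le[OF less1]])
    also have "\<dots> \<le> ?r ^ p" using that r less1 by (intro power_decreasing) auto
    finally have Tp: "onorm ?T \<le> ?r ^ p" .
    have "cmod (g m n) \<le> norm (\<phi> ?T x) * norm y" unfolding g_def by (rule cinner_bound)
    also have "\<dots> \<le> (onorm (\<phi> ?T) * norm x) * norm y"
      by (rule mult_right_mono[OF bop_norm[OF positive_map_bop[OF \<phi> T]]]) simp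
    also have "\<dots> \<le> ((2 * ?F * onorm ?T) * norm x) * norm y"
      by (intro mult_right_mono positive_map_bound_twice[OF \<phi> T]) simp_all
    also have "\<dots> = C * onorm ?T" by (simp add: C_def)
    also have "\<dots> \<le> C * ?r ^ p" by (rule mult_left_mono[OF Tp C])
    finally show ?thesis .
  qed
  \<comment> \<open>The 6 counts three error terms, each doubled.\<close>
  have le: "2 * cmod (g 0 1) \<le> B + 6 * C * ?r ^ p" if "1 \<le> p" for p
  proof -
    have "2 * cmod (g 0 1 - g p (Suc p) + g p 0 - g (Suc p) 1) \<le> B"
      unfolding g_def B_def using positive_map_kernel_estimate[OF \<phi> X _ that, of x y] less1 by simp
    moreover have "cmod (g 0 1) \<le> cmod (g 0 1 - g p (Suc p) + g p 0 - g (Suc p) 1)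
        + cmod (g p (Suc p)) + cmod (g p 0) + cmod (g (Suc p) 1)"
      by norm
    ultimately show ?thesis using g[of p p "Suc p"] g[of p p 0] g[of p "Suc p" 1] by simp
  qed
  have "(\<lambda>p. B + 6 * C * ?r ^ p) \<longlonglongrightarrow> B + 6 * C * 0"
    using r less1 by (intro tendsto_intros LIMSEQ_power_zero) simp
  then have "2 * cmod (g 0 1) \<le> B + 6 * C * 0"
    by (rule LIMSEQ_le_const) (use le in blast)
  then show "2 * cmod (cinner (\<phi> X x) y) \<le> ?F * ((norm x)\<^sup>2 + (norm y)\<^sup>2)"
    by (simp add: g_def B_def)
qed

text \<open>\<open>X\<close> is rescaled to norm \<open>t < 1\<close>, and \<open>t\<close> then
  tends to 1. An operator of norm 0 cannot be rescaled, but there the crude bound is already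
  exact.\<close>

theorem russo_dye:
  assumes \<phi>: "positive_map \<phi>" and X: "bop X"
  shows "onorm (\<phi> X) \<le> onorm (\<phi> id) * onorm X"
proof (cases "onorm X = 0")
  case True
  then show ?thesis using positive_map_bound_twice[OF assms] by simp
next
  case False
  with onorm_nonneg[OF X] have n: "0 < onorm X" by simp
  have "t * (onorm (\<phi> X) / onorm X) \<le> onorm (\<phi> id)" if t: "0 < t" "t < 1" for t
  proof -
    define s where "s = t / onorm X"
    have s: "0 < s" using t n by (simp add: s_def)
    have "onorm (\<lambda>x. s *\<^sub>R X x) = \<bar>s\<bar> * onorm X"
      by (rule onorm_scaleR[OF bop_bounded_linear[OF X]])
    then have "onorm (\<lambda>x. s *\<^sub>R X x) < 1" using t n by (simp add: s_def)
    from russo_dye_strict[OF \<phi> bop_scale_real[OF X] this]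
    have "onorm (\<lambda>x. s *\<^sub>R \<phi> X x) \<le> onorm (\<phi> id)"
      by (simp add: scaleR_scaleC linear_map_scale[OF positive_map_linear[OF \<phi>] X])
    moreover have "onorm (\<lambda>x. s *\<^sub>R \<phi> X x) = \<bar>s\<bar> * onorm (\<phi> X)"
      by (rule onorm_scaleR[OF bop_bounded_linear[OF positive_map_bop[OF \<phi> X]]])
    ultimately show ?thesis using t n by (simp add: s_def)
  qed
  then have "onorm (\<phi> X) / onorm X \<le> onorm (\<phi> id)"
    by (rule field_le_mult_one_interval)
  then show ?thesis using n by (simp add: field_simps)
qed

text \<open>By Russo-Dye the supremum is attained at the identity. This also shows that the set is
  bounded, so that its \<open>Sup\<close> is meaningful.\<close>

lemma map_norm_eq:
  assumes \<phi>: "positive_map \<phi>"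
  shows "map_norm \<phi> = onorm (\<phi> id)"
  unfolding map_norm_def
proof (rule cSup_eq_maximum)
  have "onorm (id :: 'a \<Rightarrow> 'a) \<le> 1" using onorm_id_le by (simp add: id_def)
  then show "onorm (\<phi> id) \<in> {onorm (\<phi> X) |X. X \<in> BH \<and> onorm X \<le> 1}"
    by (auto simp: BH_def)
  fix a assume "a \<in> {onorm (\<phi> X) |X. X \<in> BH \<and> onorm X \<le> 1}"
  then obtain X where X: "bop X" "onorm X \<le> 1" "a = onorm (\<phi> X)" by (auto simp: BH_def)
  have "onorm (\<phi> id) * onorm X \<le> onorm (\<phi> id) * 1"
    by (rule mult_left_mono[OF X(2) onorm_nonneg[OF positive_map_bop[OF \<phi> bop_id(1)]]])
  with russo_dye[OF \<phi> X(1)] X(3) show "a \<le> onorm (\<phi> id)" by simp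
qed

section \<open>Spectral radius, similarity, and the equivalences\<close>

text \<open>Fekete's lemma in multiplicative form, the limit being the infimum of the roots. For a
  near-optimal \<open>m\<close>, division \<open>k = q m + r\<close> gives
  \<open>a k \<le> a m ^ q * a r\<close>, and the remainder factor disappears under the
  \<open>k\<close>-th root.\<close>

lemma submultiplicative_root_limit:
  fixes a :: "nat \<Rightarrow> real"
  assumes nn: "\<And>n. 0 \<le> a n" and sub: "\<And>m n. a (m + n) \<le> a m * a n"
  obtains L where "(\<lambda>k. a k powr (1 / real k)) \<longlonglongrightarrow> L" "0 \<le> L" "\<And>m. 1 \<le> m \<Longrightarrow> L \<le> a m powr (1 / real m)"
proof -
  define b where "b k = a k powr (1 / real k)" for k
  \<comment> \<open>Index 0 is left out: \<open>1 / real 0\<close> is 0 by convention, so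
    \<open>b 0\<close> is not a genuine root.\<close>
  define L where "L = Inf (b ` {1..})"
  have bdd: "bdd_below (b ` {1..})" by (intro bdd_belowI[of _ 0]) (auto simp: b_def)
  have L_le: "L \<le> b m" if "1 \<le> m" for m
    unfolding L_def using that by (intro cINF_lower bdd) simp
  have L0: "0 \<le> L" unfolding L_def by (intro cINF_greatest) (auto simp: b_def)
  have "b \<longlonglongrightarrow> L"
  proof (rule order_tendstoI)
    fix l assume l: "l < L"
    show "\<forall>\<^sub>F k in sequentially. l < b k"
      by (rule eventually_mono[OF eventually_ge_at_top[of 1]]) (rule less_le_trans[OF l L_le])
  next
    fix u assume u: "L < u"
    define s where "s = (L + u) / 2"
    have s: "L < s" "s < u" "0 < s" using u L0 by (simp_all add: s_def)
    obtain m where m: "1 \<le> m" "b m < s"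
      using s(1) cINF_less_iff[of "{1..}" b s] bdd unfolding L_def by auto
    have am: "a m \<le> s ^ m"
    proof (cases "a m = 0")
      case False
      with nn[of m] have "0 < a m" by simp
      then have "a m = b m powr real m" unfolding b_def using m(1) by (simp add: powr_powr)
      also have "\<dots> \<le> s powr real m" using m(2) by (intro powr_mono2) (simp_all add: b_def)
      also have "\<dots> = s ^ m" using s(3) by (rule powr_realpow)
      finally show ?thesis .
    qed (use s in simp)
    have mult: "a (q * m + r) \<le> a m ^ q * a r" for q r
    proof (induction q)
      case (Suc q)
      have "a (Suc q * m + r) \<le> a m * a (q * m + r)"
        using sub[of m "q * m + r"] by (simp add: add.assoc)
      also have "\<dots> \<le> a m * (a m ^ q * a r)" by (intro mult_left_mono Suc nn)
      finally show ?case by simp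
    qed simp
    \<comment> \<open>\<open>D\<close> dominates the quotients \<open>a r / s ^ r\<close> for all
      remainders at once; the added 1 makes it positive, so its \<open>k\<close>-th roots tend to
      1.\<close>
    define D where "D = 1 + (\<Sum>r<m. a r / s ^ r)"
    have D: "0 < D" using s(3) nn by (simp add: D_def add_pos_nonneg sum_nonneg)
    have le: "a k \<le> D * s ^ k" for k
    proof -
      let ?q = "k div m" and ?r = "k mod m"
      have "a k \<le> a m ^ ?q * a ?r" using mult[of ?q ?r] by simp
      also have "\<dots> \<le> (s ^ m) ^ ?q * a ?r" by (intro mult_right_mono power_mono am nn)
      also have "\<dots> = (s ^ m) ^ ?q * s ^ ?r * (a ?r / s ^ ?r)" using s(3) by simp
      also have "(s ^ m) ^ ?q * s ^ ?r = s ^ k"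
        by (simp flip: power_mult power_add)
      also have "s ^ k * (a ?r / s ^ ?r) \<le> s ^ k * D"
      proof (rule mult_left_mono)
        have "a ?r / s ^ ?r \<le> (\<Sum>r<m. a r / s ^ r)"
          using m(1) s(3) nn by (intro member_le_sum) auto
        then show "a ?r / s ^ ?r \<le> D" by (simp add: D_def)
      qed (use s in simp)
      finally show ?thesis by (simp add: mult.commute)
    qed
    have "(\<lambda>k. D powr (1 / real k)) \<longlonglongrightarrow> D powr 0"
      using D by (intro tendsto_intros lim_1_over_n) auto
    then have "(\<lambda>k. D powr (1 / real k) * s) \<longlonglongrightarrow> D powr 0 * s"
      by (rule tendsto_mult[OF _ tendsto_const])
    then have "\<forall>\<^sub>F k in sequentially. D powr (1 / real k) * s < u"
      using D s(2) by (intro order_tendstoD(2)) auto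
    then show "\<forall>\<^sub>F k in sequentially. b k < u"
      using eventually_ge_at_top[of 1]
    proof eventually_elim
      case (elim k)
      have "b k \<le> (D * s ^ k) powr (1 / real k)"
        unfolding b_def by (intro powr_mono2 le nn) simp
      also have "\<dots> = D powr (1 / real k) * s"
        using D s(3) elim(2) by (simp add: powr_mult powr_powr flip: powr_realpow)
      finally show ?case using elim(1) by simp
    qed
  qed
  then show ?thesis using that L0 L_le unfolding b_def by blast
qed

lemma positive_map_funpow: "positive_map \<phi> \<Longrightarrow> positive_map (\<phi> ^^ k)"
proof (induction k)
  case 0
  show ?case by (simp add: positive_map_def linear_map_BH_def)
next
  case (Suc k)
  note P = Suc.IH[OF Suc.prems]
  note L = positive_map_linear[OF Suc.prems] and Lk = positive_map_linear[OF P]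
  show ?case
    unfolding positive_map_def linear_map_BH_def BH_def mem_Collect_eq funpow.simps comp_apply
  proof (intro conjI ballI allI impI)
    show "pos_op (\<phi> ((\<phi> ^^ k) X))" if "pos_op X" for X
      by (rule positive_map_pos[OF Suc.prems positive_map_pos[OF P that]])
    fix X :: "'a \<Rightarrow> 'a" assume "X \<in> {A. bop A}"
    then have X: "bop X" by simp
    show "bop (\<phi> ((\<phi> ^^ k) X))" by (rule linear_map_bop[OF L linear_map_bop[OF Lk X]])
    fix Y :: "'a \<Rightarrow> 'a" and a b assume "Y \<in> {A. bop A}"
    then have Y: "bop Y" by simp
    show "\<phi> ((\<phi> ^^ k) (\<lambda>x. scaleC a (X x) + scaleC b (Y x)))
       = (\<lambda>x. scaleC a (\<phi> ((\<phi> ^^ k) X) x) + scaleC b (\<phi> ((\<phi> ^^ k) Y) x))"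
      unfolding linear_map_combination[OF Lk X Y]
        linear_map_combination[OF L linear_map_bop[OF Lk X] linear_map_bop[OF Lk Y]] ..
  qed
qed

lemma onorm_funpow_submultiplicative:
  assumes \<phi>: "positive_map \<phi>"
  shows "onorm ((\<phi> ^^ (m + n)) id) \<le> onorm ((\<phi> ^^ m) id) * onorm ((\<phi> ^^ n) id)"
  unfolding funpow_add comp_apply
  by (rule russo_dye[OF positive_map_funpow[OF \<phi>] positive_map_bop[OF positive_map_funpow[OF \<phi>] bop_id(1)]])

text \<open>\<open>spectral_radius_map\<close> is defined by \<open>lim\<close>, so its value is
  known only once convergence is established. The last claim keeps the infimum property from
  Fekete's lemma.\<close>

lemma spectral_radius_limit:
  assumes \<phi>: "positive_map \<phi>"
  shows "(\<lambda>k. onorm ((\<phi> ^^ k) id) powr (1 / real k)) \<longlonglongrightarrow> spectral_radius_map \<phi>" (is ?lim)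
    and "0 \<le> spectral_radius_map \<phi>"
    and "\<And>m. 1 \<le> m \<Longrightarrow> spectral_radius_map \<phi> \<le> onorm ((\<phi> ^^ m) id) powr (1 / real m)"
proof -
  obtain L where L: "(\<lambda>k. onorm ((\<phi> ^^ k) id) powr (1 / real k)) \<longlonglongrightarrow> L" "0 \<le> L"
    "\<And>m. 1 \<le> m \<Longrightarrow> L \<le> onorm ((\<phi> ^^ m) id) powr (1 / real m)"
    by (rule submultiplicative_root_limit[of "\<lambda>k. onorm ((\<phi> ^^ k) id)",
          OF onorm_nonneg[OF positive_map_bop[OF positive_map_funpow[OF \<phi>] bop_id(1)]]
            onorm_funpow_submultiplicative[OF \<phi>]]) (rule that)
  moreover have "spectral_radius_map \<phi> = L"
    unfolding spectral_radius_map_def map_norm_eq[OF positive_map_funpow[OF \<phi>]] using L(1) by (rule limI)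
  ultimately show ?lim "0 \<le> spectral_radius_map \<phi>"
    "\<And>m. 1 \<le> m \<Longrightarrow> spectral_radius_map \<phi> \<le> onorm ((\<phi> ^^ m) id) powr (1 / real m)" by simp_all
qed

text \<open>By the infimum property a single power of norm below 1 suffices.\<close>

lemma spectral_radius_less_1:
  assumes \<phi>: "positive_map \<phi>" and lim: "(\<lambda>k. onorm ((\<phi> ^^ k) id)) \<longlonglongrightarrow> 0"
  shows "spectral_radius_map \<phi> < 1"
proof -
  have "\<forall>\<^sub>F k in sequentially. onorm ((\<phi> ^^ k) id) < 1"
    by (rule order_tendstoD(2)[OF lim]) simp
  then have "\<forall>\<^sub>F k in sequentially. 1 \<le> k \<and> onorm ((\<phi> ^^ k) id) < 1"
    using eventually_ge_at_top[of 1] by eventually_elim simp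
  then obtain m where m: "1 \<le> m" "onorm ((\<phi> ^^ m) id) < 1"
    by (auto simp: eventually_sequentially)
  have "onorm ((\<phi> ^^ m) id) powr (1 / real m) < 1 powr (1 / real m)"
    using m onorm_nonneg[OF positive_map_bop[OF positive_map_funpow[OF \<phi>] bop_id(1)]]
    by (intro powr_less_mono2) simp_all
  with spectral_radius_limit(3)[OF \<phi> m(1)] show ?thesis by simp
qed

lemma geometric_decay:
  assumes \<phi>: "positive_map \<phi>" and less: "spectral_radius_map \<phi> < 1"
  obtains \<rho> where "0 < \<rho>" "\<rho> < 1" "\<forall>\<^sub>F k in sequentially. onorm ((\<phi> ^^ k) id) \<le> \<rho> ^ k"
proof -
  \<comment> \<open>The midpoint between the spectral radius and 1 is positive even when the radius
    is 0.\<close>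
  define \<rho> where "\<rho> = (spectral_radius_map \<phi> + 1) / 2"
  have \<rho>: "0 < \<rho>" "\<rho> < 1" "spectral_radius_map \<phi> < \<rho>"
    using less spectral_radius_limit(2)[OF \<phi>] by (simp_all add: \<rho>_def)
  have "\<forall>\<^sub>F k in sequentially. onorm ((\<phi> ^^ k) id) powr (1 / real k) < \<rho>"
    by (rule order_tendstoD(2)[OF spectral_radius_limit(1)[OF \<phi>] \<rho>(3)])
  then have "\<forall>\<^sub>F k in sequentially. onorm ((\<phi> ^^ k) id) \<le> \<rho> ^ k"
    using eventually_ge_at_top[of 1]
  proof eventually_elim
    case (elim k)
    define a where "a = onorm ((\<phi> ^^ k) id)"
    have a: "0 \<le> a"
      unfolding a_def by (rule onorm_nonneg[OF positive_map_bop[OF positive_map_funpow[OF \<phi>] bop_id(1)]])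
    have "a = (a powr (1 / real k)) powr real k"
      using a elim(2) by (cases "a = 0") (simp_all add: powr_powr)
    also have "\<dots> \<le> \<rho> powr real k" using elim(1) by (intro powr_mono2) (simp_all add: a_def)
    also have "\<dots> = \<rho> ^ k" using \<rho>(1) by (rule powr_realpow)
    finally show ?case by (simp add: a_def)
  qed
  with that \<rho> show ?thesis by blast
qed

section \<open>Continuity of two-sided multiplication in the w*-topology\<close>

lemma topspace_wstar: "topspace wstar_topology = BH"
  unfolding wstar_topology_def topology_generated_by_topspace by auto

text \<open>The outer operators move onto the vectors, \<open>xs n\<close> becoming
  \<open>B (xs n)\<close> and \<open>ys n\<close> becoming \<open>adj A (ys n)\<close>; bounded
  operators preserve square-summability.\<close>

lemma ultraweak_functional_sandwich:
  assumes A: "bop A" and B: "bop B" and w: "ultraweak_functional w"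
  shows "ultraweak_functional (\<lambda>X. w (A \<circ> X \<circ> B))"
proof -
  from w obtain xs ys where xs: "summable (\<lambda>n. (norm (xs n))\<^sup>2)" and ys: "summable (\<lambda>n. (norm (ys n))\<^sup>2)"
    and eq: "\<And>X. X \<in> BH \<Longrightarrow> w X = (\<Sum>n. cinner (X (xs n)) (ys n))"
    unfolding ultraweak_functional_def by blast
  have summable: "summable (\<lambda>n. (norm (T (zs n)))\<^sup>2)"
    if T: "bop T" and zs: "summable (\<lambda>n. (norm (zs n))\<^sup>2)" for T :: "'a \<Rightarrow> 'a" and zs
  proof (rule summable_comparison_test'[of _ 0])
    show "summable (\<lambda>n. (onorm T)\<^sup>2 * (norm (zs n))\<^sup>2)" using zs by (rule summable_mult)
    show "norm ((norm (T (zs n)))\<^sup>2) \<le> (onorm T)\<^sup>2 * (norm (zs n))\<^sup>2" for n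
      using power_mono[OF bop_norm[OF T, of "zs n"] norm_ge_zero, of 2] by (simp add: power_mult_distrib)
  qed
  have "w (A \<circ> X \<circ> B) = (\<Sum>n. cinner (X (B (xs n))) (adj A (ys n)))" if "X \<in> BH" for X
  proof -
    have "A \<circ> X \<circ> B \<in> BH" using that A B unfolding BH_def mem_Collect_eq by (intro bop_comp_fun)
    then show ?thesis by (simp add: eq cinner_adj[OF A])
  qed
  then show ?thesis
    unfolding ultraweak_functional_def
    using summable[OF B xs] summable[OF bop_adj[OF A] ys]
    by (intro exI[of _ "\<lambda>n. B (xs n)"] exI[of _ "\<lambda>n. adj A (ys n)"] conjI ballI)
qed

text \<open>The preimage of a subbasic open set is again subbasic, by the previous lemma.\<close>

lemma wstar_continuous_sandwich:
  assumes A: "bop A" and B: "bop B"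
  shows "continuous_map wstar_topology wstar_topology (\<lambda>X. A \<circ> X \<circ> B)"
proof -
  let ?S = "insert BH {{X\<in>BH. \<omega> X \<in> U} | \<omega> U. ultraweak_functional \<omega> \<and> open U} :: ('a \<Rightarrow> 'a) set set"
  have BH: "A \<circ> X \<circ> B \<in> BH" if "X \<in> BH" for X
    using that A B unfolding BH_def mem_Collect_eq by (intro bop_comp_fun)
  have "continuous_map wstar_topology (topology_generated_by ?S) (\<lambda>X. A \<circ> X \<circ> B)"
  proof (rule continuous_on_generated_topo)
    show "(\<lambda>X. A \<circ> X \<circ> B) ` topspace wstar_topology \<subseteq> \<Union> ?S"
      unfolding topspace_wstar using BH by blast
    fix V assume "V \<in> ?S"
    then consider "V = BH" | w U where "V = {X\<in>BH. w X \<in> U}" "ultraweak_functional w" "open U" by blast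
    then show "openin wstar_topology ((\<lambda>X. A \<circ> X \<circ> B) -` V \<inter> topspace wstar_topology)"
    proof cases
      case 1
      then have "(\<lambda>X. A \<circ> X \<circ> B) -` V \<inter> topspace wstar_topology = topspace wstar_topology"
        unfolding topspace_wstar using BH by blast
      then show ?thesis by simp
    next
      case 2
      have "(\<lambda>X. A \<circ> X \<circ> B) -` V \<inter> topspace wstar_topology = {X\<in>BH. w (A \<circ> X \<circ> B) \<in> U}"
        unfolding topspace_wstar 2(1) using BH by blast
      moreover have "{X\<in>BH. w (A \<circ> X \<circ> B) \<in> U} \<in> ?S"
        using ultraweak_functional_sandwich[OF A B 2(2)] 2(3)
        by (intro insertI2 CollectI exI[of _ "\<lambda>X. w (A \<circ> X \<circ> B)"] exI[of _ U]) simp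
      ultimately show ?thesis
        unfolding wstar_topology_def by (simp only: topology_generated_by_Basis)
    qed
  qed
  then show ?thesis unfolding wstar_topology_def .
qed

section \<open>The Neumann series and the implications between the conditions\<close>

lemma bop_of_symmetric:
  assumes "bounded_linear A" and sym: "\<And>x y. cinner (A x) y = cinner x (A y)"
  shows "bop A"
  unfolding bop_iff
proof (intro conjI allI)
  show "A (scaleC c x) = scaleC c (A x)" for c x
    by (rule cinner_ext) (simp add: sym[symmetric] cinner_linear)
qed (rule assms(1))

lemma pos_op_congruence:
  assumes T: "pos_op T" and A: "bop A"
  shows "pos_op (adj A \<circ> T \<circ> A)"
  using pos_op_bop[OF T] A T
  by (auto simp: pos_op_def cinner_adj'[OF A] intro!: bop_comp_fun)

lemma pos_op_invertible_op_id: "pos_op id" "invertible_op id"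
  using pos_op_id by (auto simp: invertible_op_def intro: exI[of _ id])

lemma positive_map_funpow_bound:
  assumes \<phi>: "positive_map \<phi>" and X: "bop X"
  shows "onorm ((\<phi> ^^ k) X) \<le> onorm ((\<phi> ^^ k) id) * onorm X"
  by (rule russo_dye[OF positive_map_funpow[OF \<phi>] X])

text \<open>Russo-Dye makes \<phi> bounded for the operator norm, which lets it pass through norm
  limits.\<close>

lemma positive_map_tendsto:
  assumes \<phi>: "positive_map \<phi>" and S: "\<And>n. bop (S n)" and X: "bop X"
    and lim: "(\<lambda>n. onorm (\<lambda>x. X x - S n x)) \<longlonglongrightarrow> 0"
  shows "(\<lambda>n. \<phi> (S n) x) \<longlonglongrightarrow> \<phi> X x"
proof -
  let ?F = "onorm (\<phi> id)"
  have le: "norm (\<phi> (S n) x - \<phi> X x) \<le> ?F * onorm (\<lambda>x. X x - S n x) * norm x" for n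
  proof -
    have "norm (\<phi> X x - \<phi> (S n) x) \<le> onorm (\<phi> (\<lambda>x. X x - S n x)) * norm x"
      using bop_norm[OF positive_map_bop[OF \<phi> bop_sub[OF X S]], of n x]
      unfolding linear_map_diff[OF positive_map_linear[OF \<phi>] X S] .
    also have "\<dots> \<le> ?F * onorm (\<lambda>x. X x - S n x) * norm x"
      by (rule mult_right_mono[OF russo_dye[OF \<phi> bop_sub[OF X S]]]) simp
    finally show ?thesis by (simp add: norm_minus_commute)
  qed
  have "(\<lambda>n. ?F * onorm (\<lambda>x. X x - S n x) * norm x) \<longlonglongrightarrow> ?F * 0 * norm x"
    by (intro tendsto_intros lim)
  then have "(\<lambda>n. ?F * onorm (\<lambda>x. X x - S n x) * norm x) \<longlonglongrightarrow> 0" by simp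
  then have "(\<lambda>n. \<phi> (S n) x - \<phi> X x) \<longlonglongrightarrow> 0"
    by (rule Lim_null_comparison[rotated]) (simp add: le)
  then show ?thesis by (simp add: LIM_zero_iff)
qed

text \<open>The solution is the sum of \<open>(\<phi> ^^ k) R\<close>, which converges in norm by
  geometric decay. Its term at \<open>k = 0\<close> is \<open>R\<close> and the others are positive,
  so it inherits the lower bound of \<open>R\<close> and with it invertibility.\<close>

lemma neumann_solution:
  assumes \<phi>: "positive_map \<phi>" and less: "spectral_radius_map \<phi> < 1"
    and R: "pos_op R" "invertible_op R"
  shows "\<exists>X. invertible_op X \<and> pos_op X \<and> (\<lambda>x. X x - \<phi> X x) = R"
proof -
  define F where "F k = (\<phi> ^^ k) R" for k
  define B where "B k = Blinfun (F k)" for k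
  have bR: "bop R" using R(1) by (rule pos_op_bop)
  have posF: "pos_op (F k)" for k
    unfolding F_def by (rule positive_map_pos[OF positive_map_funpow[OF \<phi>] R(1)])
  have bF: "bop (F k)" for k by (rule pos_op_bop[OF posF])
  have B: "blinfun_apply (B k) = F k" for k
    unfolding B_def by (rule bounded_linear_Blinfun_apply[OF bop_bounded_linear[OF bF]])
  have nB: "norm (B k) = onorm (F k)" for k by (simp add: norm_blinfun.rep_eq B)
  obtain \<rho> where \<rho>: "0 < \<rho>" "\<rho> < 1" "\<forall>\<^sub>F k in sequentially. onorm ((\<phi> ^^ k) id) \<le> \<rho> ^ k"
    by (rule geometric_decay[OF \<phi> less]) (rule that)
  have "\<forall>\<^sub>F k in sequentially. norm (B k) \<le> \<rho> ^ k * onorm R"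
    using \<rho>(3)
  proof eventually_elim
    case (elim k)
    then show ?case
      using positive_map_funpow_bound[OF \<phi> bR, of k] mult_right_mono[OF elim onorm_nonneg[OF bR]]
      unfolding nB F_def by linarith
  qed
  moreover have "summable (\<lambda>k. \<rho> ^ k * onorm R)"
    using \<rho> by (intro summable_mult2 summable_geometric) simp
  ultimately have summ: "summable B" by (rule summable_comparison_test_ev)
  define Y where "Y = suminf B"
  define X where "X = blinfun_apply Y"
  define S where "S n = (\<lambda>x. \<Sum>k<n. F k x)" for n
  have S: "blinfun_apply (\<Sum>k<n. B k) = S n" for n
    by (rule ext) (simp add: S_def blinfun.sum_left B)
  have bS: "bop (S n)" for n unfolding S_def by (rule bop_sum[OF bF])
  have limY: "(\<lambda>n. \<Sum>k<n. B k) \<longlonglongrightarrow> Y" unfolding Y_def by (rule summable_LIMSEQ[OF summ])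
  have limX: "(\<lambda>n. S n x) \<longlonglongrightarrow> X x" for x
    unfolding X_def S[symmetric] by (intro tendsto_intros limY)
  have limc: "(\<lambda>n. cinner (S n x) y) \<longlonglongrightarrow> cinner (X x) y" for x y
    by (rule bounded_bilinear.tendsto[OF bounded_bilinear_cinner limX tendsto_const])
  have "(\<lambda>n. norm (Y - (\<Sum>k<n. B k))) \<longlonglongrightarrow> norm (Y - Y)"
    by (intro tendsto_intros limY)
  moreover have "blinfun_apply (Y - (\<Sum>k<n. B k)) = (\<lambda>x. X x - S n x)" for n
    by (rule ext) (simp only: X_def blinfun.diff_left S)
  then have "norm (Y - (\<Sum>k<n. B k)) = onorm (\<lambda>x. X x - S n x)" for n
    by (simp only: norm_blinfun.rep_eq)
  ultimately have norm_lim: "(\<lambda>n. onorm (\<lambda>x. X x - S n x)) \<longlonglongrightarrow> 0" by simp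
  have sym: "cinner (X x) y = cinner x (X y)" for x y
  proof (rule LIMSEQ_unique[OF limc])
    have "(\<lambda>n. cinner x (S n y)) \<longlonglongrightarrow> cinner x (X y)"
      by (rule bounded_bilinear.tendsto[OF bounded_bilinear_cinner tendsto_const limX])
    then show "(\<lambda>n. cinner (S n x) y) \<longlonglongrightarrow> cinner x (X y)"
      by (simp add: S_def cinner_sum_left cinner_sum_right pos_op_symmetric[OF posF])
  qed
  \<comment> \<open>The limit was formed among real-linear operators; symmetry restores complex
    linearity.\<close>
  have bX: "bop X"
    by (rule bop_of_symmetric[OF _ sym]) (simp add: X_def blinfun.bounded_linear_right)
  have ge: "Re (cinner (R x) x) \<le> Re (cinner (X x) x)" for x
  proof (rule LIMSEQ_le_const[OF tendsto_Re[OF limc]])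
    have "Re (cinner (R x) x) \<le> Re (cinner (S n x) x)" if "1 \<le> n" for n
    proof -
      have "Re (cinner (F 0 x) x) \<le> (\<Sum>k<n. Re (cinner (F k x) x))"
        using that by (intro member_le_sum pos_op_nonneg posF) auto
      then show ?thesis by (simp add: S_def cinner_sum_left F_def)
    qed
    then show "\<exists>N. \<forall>n\<ge>N. Re (cinner (R x) x) \<le> Re (cinner (S n x) x)" by blast
  qed
  have posX: "pos_op X"
    using order_trans[OF pos_op_nonneg[OF R(1)] ge] by (rule pos_opI[OF bX sym])
  obtain e where e: "0 < e" "\<And>x. e * (norm x)\<^sup>2 \<le> Re (cinner (R x) x)"
    using pos_op_invertible_bounded_below[OF R] by blast
  have invX: "invertible_op X"
    by (rule bounded_below_invertible[OF posX e(1) order_trans[OF e(2) ge]])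
  have "X x - \<phi> X x = R x" for x
  proof -
    \<comment> \<open>\<phi> shifts the index by one, so the partial sum gains a term at the top and
      loses \<open>R\<close> at the bottom.\<close>
    have \<phi>S: "\<phi> (S n) x = S (Suc n) x - R x" for n
    proof -
      have "\<phi> (S n) = (\<lambda>x. \<Sum>k<n. scaleC 1 (\<phi> (F k) x))"
        using linear_map_sum[OF positive_map_linear[OF \<phi>] bF, where I = "{..<n}" and c = "\<lambda>_. 1"]
        by (simp only: S_def scaleC_one)
      then show ?thesis by (simp only: S_def sum.lessThan_Suc_shift) (simp add: F_def scaleC_one)
    qed
    have "(\<lambda>n. S (Suc n) x - R x) \<longlonglongrightarrow> X x - R x"
      by (intro tendsto_intros LIMSEQ_Suc limX)
    moreover have "(\<lambda>n. S (Suc n) x - R x) \<longlonglongrightarrow> \<phi> X x"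
      using positive_map_tendsto[OF \<phi> bS bX norm_lim, of x] unfolding \<phi>S .
    ultimately have "X x - R x = \<phi> X x" by (rule LIMSEQ_unique)
    then show ?thesis by (simp add: algebra_simps)
  qed
  with posX invX show ?thesis by blast
qed

lemma similar_contraction_exists:
  assumes cont: "wstar_continuous \<phi>" and \<phi>: "positive_map \<phi>"
    and Q: "invertible_op Q" "pos_op Q" and le: "op_le (\<phi> Q) Q"
    and inv: "invertible_op (\<lambda>x. Q x - \<phi> Q x)"
  shows "\<exists>\<psi>. wstar_continuous \<psi> \<and> positive_map \<psi> \<and> map_norm \<psi> < 1 \<and> similar_maps \<phi> \<psi>"
proof -
  note L = positive_map_linear[OF \<phi>]
  obtain R where R: "invertible_op R" "adj R = R" and RR: "\<And>x. R (R x) = Q x"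
    by (rule pos_op_square_root[OF Q(2,1)]) (rule that)
  then obtain P where bR: "bop R" and bP: "bop P" and PR: "\<And>x. P (R x) = x" and RP: "\<And>x. R (P x) = x"
    unfolding invertible_op_def by blast
  have symR: "cinner (R x) y = cinner x (R y)" for x y
    using cinner_adj[OF bR, of x y] by (simp add: R(2))
  have symP: "cinner (P x) y = cinner x (P y)" for x y
    using symR[of "P x" "P y"] by (simp add: RP)
  have adjP: "adj P = P" by (rule adj_unique[OF bP symP])
  \<comment> \<open>With \<open>P\<close> the inverse of the root \<open>R\<close> of
    \<open>Q\<close>, conjugation turns \<open>\<phi> Q\<close> into
    \<open>\<psi> id = P \<circ> \<phi> Q \<circ> P\<close>.\<close>
  define \<psi> where "\<psi> X = P \<circ> \<phi> (R \<circ> X \<circ> R) \<circ> P" for X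
  have bRXR: "bop (R \<circ> X \<circ> R)" if "bop X" for X by (intro bop_comp_fun bR that)
  have "continuous_map wstar_topology wstar_topology
      ((\<lambda>X. P \<circ> X \<circ> P) \<circ> (\<phi> \<circ> (\<lambda>X. R \<circ> X \<circ> R)))"
    by (intro continuous_map_compose[of _ wstar_topology] wstar_continuous_sandwich bP bR
        cont[unfolded wstar_continuous_def])
  moreover have "(\<lambda>X. P \<circ> X \<circ> P) \<circ> (\<phi> \<circ> (\<lambda>X. R \<circ> X \<circ> R)) = \<psi>"
    by (rule ext) (simp add: \<psi>_def)
  ultimately have cont\<psi>: "wstar_continuous \<psi>" unfolding wstar_continuous_def by simp
  have lin\<psi>: "linear_map_BH \<psi>"
    unfolding linear_map_BH_def BH_def
  proof (intro conjI ballI allI)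
    fix X :: "'a \<Rightarrow> 'a" assume "X \<in> {A. bop A}"
    then have X: "bop X" by simp
    have "bop (\<psi> X)" unfolding \<psi>_def by (intro bop_comp_fun bP linear_map_bop[OF L bRXR[OF X]])
    then show "\<psi> X \<in> {A. bop A}" by simp
    fix Y :: "'a \<Rightarrow> 'a" and a b assume "Y \<in> {A. bop A}"
    then have Y: "bop Y" by simp
    have eq: "R \<circ> (\<lambda>x. scaleC a (X x) + scaleC b (Y x)) \<circ> R
        = (\<lambda>x. scaleC a ((R \<circ> X \<circ> R) x) + scaleC b ((R \<circ> Y \<circ> R) x))"
      by (rule ext) (simp add: bop_linear[OF bR])
    show "\<psi> (\<lambda>x. scaleC a (X x) + scaleC b (Y x)) = (\<lambda>x. scaleC a (\<psi> X x) + scaleC b (\<psi> Y x))"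
      unfolding \<psi>_def eq linear_map_combination[OF L bRXR[OF X] bRXR[OF Y]]
      by (rule ext) (simp add: bop_linear[OF bP])
  qed
  have pos\<psi>: "positive_map \<psi>"
    unfolding positive_map_def
  proof (intro conjI allI impI lin\<psi>)
    fix X :: "'a \<Rightarrow> 'a" assume X: "pos_op X"
    have "pos_op (R \<circ> X \<circ> R)" using pos_op_congruence[OF X bR] by (simp add: R(2))
    from pos_op_congruence[OF positive_map_pos[OF \<phi> this] bP]
    show "pos_op (\<psi> X)" by (simp add: \<psi>_def adjP)
  qed
  obtain e where e: "0 < e" "\<And>x. e * (norm x)\<^sup>2 \<le> Re (cinner (Q x - \<phi> Q x) x)"
    using pos_op_invertible_bounded_below[OF le[unfolded op_le_def] inv] by blast
  have bQ: "bop Q" using Q(2) by (rule pos_op_bop)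
  \<comment> \<open>Since \<open>Q - \<phi> Q\<close> is at least \<open>e\<close> and
    \<open>Q\<close> is at most \<open>M\<close>, the difference is at least
    \<open>(e / M) Q\<close>, that is \<open>\<phi> Q \<le> c Q\<close>. Including \<open>e\<close>
    in \<open>M\<close> keeps \<open>c\<close> positive.\<close>
  define M where "M = onorm Q + e + 1"
  have M: "0 < M" "e < M" using e(1) onorm_nonneg[OF bQ] by (simp_all add: M_def)
  define c where "c = 1 - e / M"
  have c: "0 < c" "c < 1" using e(1) M by (simp_all add: c_def)
  have \<phi>Q: "Re (cinner (\<phi> Q x) x) \<le> c * Re (cinner (Q x) x)" for x
  proof -
    have "onorm Q * (norm x)\<^sup>2 \<le> M * (norm x)\<^sup>2"
      using e(1) by (intro mult_right_mono) (simp_all add: M_def)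
    then have "Re (cinner (Q x) x) \<le> M * (norm x)\<^sup>2"
      using Re_cinner_le_onorm[OF bQ, of x] by linarith
    then have "e / M * Re (cinner (Q x) x) \<le> e / M * (M * (norm x)\<^sup>2)"
      using e(1) M(1) by (intro mult_left_mono) simp_all
    then have "e / M * Re (cinner (Q x) x) \<le> e * (norm x)\<^sup>2" using M(1) by simp
    with e(2)[of x] show ?thesis by (simp add: c_def cinner_linear left_diff_distrib)
  qed
  have "\<psi> id = P \<circ> \<phi> Q \<circ> P"
  proof -
    have "R \<circ> id \<circ> R = Q" by (rule ext) (simp add: RR)
    then show ?thesis by (simp add: \<psi>_def)
  qed
  then have \<psi>id: "Re (cinner (\<psi> id x) x) \<le> c * (norm x)\<^sup>2" for x
    using \<phi>Q[of "P x"] by (simp add: symP symR RP cinner_self flip: RR)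
  have "onorm (\<psi> id) \<le> c"
  proof (rule onorm_bound)
    show "norm (\<psi> id x) \<le> c * norm x" for x
      by (rule pos_op_norm_le[OF positive_map_pos[OF pos\<psi> pos_op_id] c(1) \<psi>id])
  qed (use c in simp)
  then have "map_norm \<psi> < 1" using c(2) by (simp add: map_norm_eq[OF pos\<psi>])
  moreover have "similar_maps \<phi> \<psi>"
    unfolding similar_maps_def
  proof (intro exI[of _ R] conjI ballI R(1))
    show "\<phi> (R \<circ> X \<circ> adj R) = R \<circ> \<psi> X \<circ> adj R" for X
      by (rule ext) (simp add: R(2) \<psi>_def RP PR)
  qed
  ultimately show ?thesis using cont\<psi> pos\<psi> by blast
qed

text \<open>For \<open>S\<close> the inverse of \<open>R\<close> and
  \<open>X = S \<circ> adj S\<close> one has \<open>R \<circ> X \<circ> adj R = id\<close>. Hence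
  the powers of \<phi> at \<open>id\<close> are the powers of \<psi> at \<open>X\<close>, conjugated
  by \<open>R\<close>, and these decay geometrically.\<close>

lemma similar_contraction_powers_tendsto_0:
  assumes \<psi>: "positive_map \<psi>" and less: "map_norm \<psi> < 1" and sim: "similar_maps \<phi> \<psi>"
  shows "(\<lambda>k. onorm ((\<phi> ^^ k) id)) \<longlonglongrightarrow> 0"
proof -
  obtain R where R: "invertible_op R"
    and eq: "\<And>X. X \<in> BH \<Longrightarrow> \<phi> (R \<circ> X \<circ> adj R) = R \<circ> \<psi> X \<circ> adj R"
    using sim unfolding similar_maps_def by blast
  then obtain S where bR: "bop R" and bS: "bop S" and RS: "\<And>x. R (S x) = x"
    unfolding invertible_op_def by blast
  define X where "X = S \<circ> adj S"
  have bX: "bop X" unfolding X_def by (intro bop_comp_fun bS bop_adj)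
  have b\<psi>: "bop ((\<psi> ^^ k) X)" for k by (rule positive_map_bop[OF positive_map_funpow[OF \<psi>] bX])
  have "adj S (adj R x) = x" for x
    by (rule cinner_ext) (simp add: RS flip: cinner_adj[OF bS] cinner_adj[OF bR])
  then have id: "R \<circ> X \<circ> adj R = id" by (intro ext) (simp add: X_def RS)
  have pow: "(\<phi> ^^ k) id = R \<circ> (\<psi> ^^ k) X \<circ> adj R" for k
  proof (induction k)
    case (Suc k)
    have "(\<phi> ^^ Suc k) id = \<phi> ((\<phi> ^^ k) id)" by (simp only: funpow.simps comp_apply)
    moreover have "(\<psi> ^^ Suc k) X = \<psi> ((\<psi> ^^ k) X)" by (simp only: funpow.simps comp_apply)
    moreover have "(\<psi> ^^ k) X \<in> BH" using b\<psi>[of k] by (simp only: BH_def mem_Collect_eq)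
    ultimately show ?case using eq[of "(\<psi> ^^ k) X"] by (simp only: Suc.IH)
  qed (simp only: funpow_0 id)
  define c where "c = onorm (\<psi> id)"
  have c: "0 \<le> c" "c < 1"
    using less onorm_nonneg[OF positive_map_bop[OF \<psi> bop_id(1)]] by (simp_all add: c_def map_norm_eq[OF \<psi>])
  have "onorm ((\<psi> ^^ k) X) \<le> c ^ k * onorm X" for k
  proof (induction k)
    case (Suc k)
    have "onorm (\<psi> ((\<psi> ^^ k) X)) \<le> c * onorm ((\<psi> ^^ k) X)"
      unfolding c_def by (rule russo_dye[OF \<psi> b\<psi>])
    also have "\<dots> \<le> c * (c ^ k * onorm X)" using Suc c(1) by (intro mult_left_mono)
    finally show ?case by simp
  qed simp
  then have bound: "onorm ((\<phi> ^^ k) id) \<le> onorm R * (c ^ k * onorm X) * onorm (adj R)" for k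
  proof -
    note bl = bop_bounded_linear
    have "onorm ((\<phi> ^^ k) id) \<le> onorm (R \<circ> (\<psi> ^^ k) X) * onorm (adj R)"
      unfolding pow by (rule onorm_compose[OF bl[OF bop_comp_fun[OF bR b\<psi>]] bl[OF bop_adj[OF bR]]])
    also have "\<dots> \<le> onorm R * onorm ((\<psi> ^^ k) X) * onorm (adj R)"
      by (rule mult_right_mono[OF onorm_compose[OF bl[OF bR] bl[OF b\<psi>]] onorm_nonneg[OF bop_adj[OF bR]]])
    also have "\<dots> \<le> onorm R * (c ^ k * onorm X) * onorm (adj R)"
      using \<open>onorm ((\<psi> ^^ k) X) \<le> c ^ k * onorm X\<close>
      by (intro mult_right_mono mult_left_mono onorm_nonneg bR bop_adj)
    finally show ?thesis .
  qed
  have nn: "0 \<le> onorm ((\<phi> ^^ k) id)" for k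
    unfolding pow by (rule onorm_nonneg[OF bop_comp_fun[OF bop_comp_fun[OF bR b\<psi>] bop_adj[OF bR]]])
  have "(\<lambda>k. onorm R * (c ^ k * onorm X) * onorm (adj R)) \<longlonglongrightarrow> onorm R * (0 * onorm X) * onorm (adj R)"
    using c by (intro tendsto_intros LIMSEQ_power_zero) simp
  then have "(\<lambda>k. onorm R * (c ^ k * onorm X) * onorm (adj R)) \<longlonglongrightarrow> 0" by simp
  then show ?thesis
    by (rule Lim_null_comparison[OF always_eventually, rotated]) (simp add: bound nn)
qed

text \<open>Substituting \<open>R = X - \<phi> X\<close> telescopes the partial sum to
  \<open>X - (\<phi> ^^ n) X\<close>. As \<open>X\<close> is an arbitrary bounded solution,
  uniqueness follows from uniqueness of norm limits.\<close>

lemma partial_sums_converge: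
  assumes \<phi>: "positive_map \<phi>" and lim: "(\<lambda>k. onorm ((\<phi> ^^ k) id)) \<longlonglongrightarrow> 0"
    and X: "bop X" and eq: "(\<lambda>x. X x - \<phi> X x) = R"
  shows "(\<lambda>n. onorm (\<lambda>x. (\<Sum>k<n. (\<phi> ^^ k) R x) - X x)) \<longlonglongrightarrow> 0"
proof -
  have b: "bop ((\<phi> ^^ k) X)" for k by (rule positive_map_bop[OF positive_map_funpow[OF \<phi>] X])
  have "(\<phi> ^^ k) R = (\<lambda>x. (\<phi> ^^ k) X x - (\<phi> ^^ Suc k) X x)" for k
    unfolding eq[symmetric]
      linear_map_diff[OF positive_map_linear[OF positive_map_funpow[OF \<phi>]] X positive_map_bop[OF \<phi> X]]
    by (simp add: funpow_swap1)
  then have "(\<Sum>k<n. (\<phi> ^^ k) R x) = X x - (\<phi> ^^ n) X x" for n x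
    using sum_lessThan_telescope'[of "\<lambda>k. (\<phi> ^^ k) X x" n] by (simp only: funpow_0)
  then have "(\<lambda>x. (\<Sum>k<n. (\<phi> ^^ k) R x) - X x) = (\<lambda>x. - (\<phi> ^^ n) X x)" for n
    by (simp only:) simp
  then have eq': "onorm (\<lambda>x. (\<Sum>k<n. (\<phi> ^^ k) R x) - X x) = onorm ((\<phi> ^^ n) X)" for n
    by (simp only: onorm_neg)
  have "(\<lambda>n. onorm ((\<phi> ^^ n) id) * onorm X) \<longlonglongrightarrow> 0"
    using tendsto_mult_left_zero[OF lim] .
  then show ?thesis
    unfolding eq' by (rule Lim_null_comparison[OF always_eventually, rotated])
      (simp add: onorm_nonneg[OF b] positive_map_funpow_bound[OF \<phi> X])
qed

theorem theorem5p9: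
  fixes \<phi> :: "('a::chilbert \<Rightarrow> 'a) \<Rightarrow> ('a \<Rightarrow> 'a)"
  assumes "wstar_continuous \<phi>" and "positive_map \<phi>"
  defines "C1 \<equiv> (\<exists>\<psi>. wstar_continuous \<psi> \<and> positive_map \<psi> \<and> map_norm \<psi> < 1 \<and> similar_maps \<phi> \<psi>)"
    and "C2 \<equiv> (\<forall>R. invertible_op R \<and> pos_op R \<longrightarrow>
                 (\<exists>X. invertible_op X \<and> pos_op X \<and> (\<lambda>x. X x - \<phi> X x) = R))"
    and "C3 \<equiv> (\<exists>Q. invertible_op Q \<and> pos_op Q \<and> op_le (\<phi> Q) Q \<and> invertible_op (\<lambda>x. Q x - \<phi> Q x))"
    and "C5 \<equiv> (\<lambda>k. onorm ((\<phi> ^^ k) id)) \<longlonglongrightarrow> 0"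
    and "C6 \<equiv> spectral_radius_map \<phi> < 1"
  shows "(C1 \<longleftrightarrow> C2) \<and> (C2 \<longleftrightarrow> C3) \<and> (C3 \<longleftrightarrow> C5) \<and> (C5 \<longleftrightarrow> C6) \<and>
    (C1 \<longrightarrow> (\<forall>R X. invertible_op R \<and> pos_op R \<and> pos_op X \<and> (\<lambda>x. X x - \<phi> X x) = R \<longrightarrow>
        (\<lambda>n. onorm (\<lambda>x. (\<Sum>k<n. (\<phi> ^^ k) R x) - X x)) \<longlonglongrightarrow> 0))"
proof -
  have 23: "C3" if C2
  proof -
    \<comment> \<open>The solution for right-hand side \<open>id\<close> serves as \<open>Q\<close>:
      the difference \<open>Q - \<phi> Q\<close> is then the identity, both positive and
      invertible.\<close>
    obtain Q where "invertible_op Q" "pos_op Q" "(\<lambda>x. Q x - \<phi> Q x) = id"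
      using \<open>C2\<close> pos_op_invertible_op_id unfolding C2_def by blast
    then show C3 unfolding C3_def op_le_def using pos_op_invertible_op_id by (intro exI[of _ Q]) simp
  qed
  have 31: "C1" if C3
  proof -
    obtain Q where "invertible_op Q" "pos_op Q" "op_le (\<phi> Q) Q" "invertible_op (\<lambda>x. Q x - \<phi> Q x)"
      using \<open>C3\<close> unfolding C3_def by blast
    then show C1 unfolding C1_def by (rule similar_contraction_exists[OF assms(1,2)])
  qed
  have 15: "C5" if C1
  proof -
    obtain \<psi> where "positive_map \<psi>" "map_norm \<psi> < 1" "similar_maps \<phi> \<psi>"
      using \<open>C1\<close> unfolding C1_def by blast
    then show C5 unfolding C5_def by (rule similar_contraction_powers_tendsto_0)
  qed
  have 56: "C6" if C5
    using that unfolding C5_def C6_def by (rule spectral_radius_less_1[OF assms(2)])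
  have 62: "C2" if C6
    unfolding C2_def by (intro allI impI neumann_solution[OF assms(2) that[unfolded C6_def]]) simp_all
  \<comment> \<open>Uniqueness is contained here: every positive solution is the norm limit of one
    sequence that depends only on \<open>R\<close>.\<close>
  have "\<forall>R X. invertible_op R \<and> pos_op R \<and> pos_op X \<and> (\<lambda>x. X x - \<phi> X x) = R \<longrightarrow>
        (\<lambda>n. onorm (\<lambda>x. (\<Sum>k<n. (\<phi> ^^ k) R x) - X x)) \<longlonglongrightarrow> 0" if C1
  proof (intro allI impI)
    fix R X assume "invertible_op R \<and> pos_op R \<and> pos_op X \<and> (\<lambda>x. X x - \<phi> X x) = R"
    then have "bop X" "(\<lambda>x. X x - \<phi> X x) = R" by (simp_all add: pos_op_bop)
    then show "(\<lambda>n. onorm (\<lambda>x. (\<Sum>k<n. (\<phi> ^^ k) R x) - X x)) \<longlonglongrightarrow> 0"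
      by (rule partial_sums_converge[OF assms(2) 15[OF that, unfolded C5_def]])
  qed
  with 23 31 15 56 62 show ?thesis by blast
qed

end
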